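(* Let $\mathcal H\subset\mathbb R^2$ be a nonempty bounded open set with $B_2(0)\subset\mathcal H\subset B_{\mathcal R}(0)$ for some $\mathcal R\in(2,\infty)$. Let $J\in C^2_c(\mathbb R^2)$ be radially symmetric with $J(x)>0$ if $|x|<d$, $J(x)=0$ if $|x|\ge d$ (for some $d>0$), and $\int_{\mathbb R^2}J=1$. Let $u_0\ge0$ with $u_0=0$ in $\mathcal H$, $u_0\in L^\infty(\mathbb R^2)$, $u_0\in L^1(\mathbb R^2,\log|x|\,dx)$ and $u_0\in L^1(\mathbb R^2,|x|^2\,dx)$. Let $u$ be the solution of the nonlocal exterior problem with hole $\mathcal H$ and initial datum $u_0$, and let $M_\phi^*=\int_{\mathbb R^2}u_0\phi$, where $\phi$ is the stationary solution with logarithmic behavior at infinity. Then $$\log t\int_{\mathbb R^2}u(x,t)\,dx\to2M_\phi^*\quad\text{as }t\to\infty.$$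
   Context: $L$ is the operator $Lg:=J*g-g$. The solution $u\in C([0,\infty);L^1(\mathbb R^2))$ is the unique solution of: $\partial_tu=Lu$ in $(\mathbb R^2\setminus\mathcal H)\times(0,\infty)$, $u=0$ in $\mathcal H\times(0,\infty)$, $u(\cdot,0)=u_0$ in $\mathbb R^2$. $\phi$ is the unique (locally bounded measurable) function with $L\phi=0$ in $\mathbb R^2\setminus\mathcal H$, $\phi=0$ in $\mathcal H$, and $\phi(x)-\log|x|\in L^\infty(\mathbb R^2\setminus\mathcal H)$. *)

theory Defs
  imports "HOL-Analysis.Analysis"
begin

definition C2_compact :: "('a::euclidean_space \<Rightarrow> real) \<Rightarrow> bool" where
  "C2_compact f \<longleftrightarrow>
     (\<exists>(f' :: 'a \<Rightarrow> 'a \<Rightarrow>\<^sub>L real) (f'' :: 'a \<Rightarrow> 'a \<Rightarrow>\<^sub>L 'a \<Rightarrow>\<^sub>L real).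
        (\<forall>x. (f has_derivative blinfun_apply (f' x)) (at x)) \<and>
        (\<forall>x. (f' has_derivative blinfun_apply (f'' x)) (at x)) \<and>
        continuous_on UNIV f'') \<and>
     compact (closure {x. f x \<noteq> 0})"

definition Linfty_on :: "'a::euclidean_space set \<Rightarrow> ('a \<Rightarrow> real) \<Rightarrow> bool" where
  "Linfty_on S f \<longleftrightarrow>
     f \<in> borel_measurable (lebesgue_on S) \<and> (\<exists>C. AE x in lebesgue_on S. \<bar>f x\<bar> \<le> C)"

definition conv :: "('a::euclidean_space \<Rightarrow> real) \<Rightarrow> ('a \<Rightarrow> real) \<Rightarrow> 'a \<Rightarrow> real" where
  "conv J g x = (LINT y|lebesgue. J (x - y) * g y)"

definition nonlocal_op :: "('a::euclidean_space \<Rightarrow> real) \<Rightarrow> ('a \<Rightarrow> real) \<Rightarrow> 'a \<Rightarrow> real" where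
  "nonlocal_op J g x = conv J g x - g x"

text \<open>
  \<open>u \<in> C([0,\<infinity>); L\<^sup>1)\<close>: each \<open>u t\<close> is a representative of an \<open>L\<^sup>1\<close> class, and
  continuity is with respect to the \<open>L\<^sup>1\<close> norm. Values \<open>u t\<close> for \<open>t < 0\<close> are unconstrained.
\<close>

definition C_L1 :: "(real \<Rightarrow> 'a::euclidean_space \<Rightarrow> real) \<Rightarrow> bool" where
  "C_L1 u \<longleftrightarrow>
     (\<forall>t\<ge>0. integrable lebesgue (u t)) \<and>
     (\<forall>t\<ge>0. ((\<lambda>s. LINT x|lebesgue. \<bar>u s x - u t x\<bar>) \<longlongrightarrow> 0) (at t within {0..}))"

text \<open>
  Since \<open>u t\<close> is only an \<open>L\<^sup>1\<close> class, the time derivative in the equation outside the hole is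
  that of the curve \<open>t \<mapsto> u t\<close> in \<open>L\<^sup>1(- H)\<close>: the difference quotients converge to \<open>J * u t - u t\<close>
  in the norm of that space. The other two conditions are equalities of \<open>L\<^sup>1\<close> classes.
\<close>

definition exterior_solution ::
  "('a::euclidean_space \<Rightarrow> real) \<Rightarrow> 'a set \<Rightarrow> ('a \<Rightarrow> real) \<Rightarrow> (real \<Rightarrow> 'a \<Rightarrow> real) \<Rightarrow> bool" where
  "exterior_solution J H u\<^sub>0 u \<longleftrightarrow>
     C_L1 u \<and>
     (\<forall>t>0. ((\<lambda>s. LINT x|lebesgue_on (- H).
                 \<bar>(u s x - u t x) / (s - t) - nonlocal_op J (u t) x\<bar>) \<longlongrightarrow> 0) (at t)) \<and>
     (\<forall>t>0. AE x in lebesgue. x \<in> H \<longrightarrow> u t x = 0) \<and>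
     (AE x in lebesgue. u 0 x = u\<^sub>0 x)"

text \<open>
  The stationary solution is an actual function, not a class: it satisfies its equation at every
  point, which makes sense because \<open>conv J \<phi>\<close> is defined everywhere when \<open>\<phi>\<close> is locally bounded
  and measurable and \<open>J\<close> is continuous with compact support.
\<close>

definition log_stationary ::
  "('a::euclidean_space \<Rightarrow> real) \<Rightarrow> 'a set \<Rightarrow> ('a \<Rightarrow> real) \<Rightarrow> bool" where
  "log_stationary J H \<phi> \<longleftrightarrow>
     \<phi> \<in> borel_measurable lebesgue \<and>
     (\<forall>K. compact K \<longrightarrow> bounded (\<phi> ` K)) \<and>
     (\<forall>x. x \<notin> H \<longrightarrow> nonlocal_op J \<phi> x = 0) \<and>
     (\<forall>x\<in>H. \<phi> x = 0) \<and>
     Linfty_on (- H) (\<lambda>x. \<phi> x - ln (norm x))"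

end

theory Submission
  imports Defs "HOL-Real_Asymp.Real_Asymp"
begin

text \<open>
  Let $T g = 1_{-H} \, (J * g)$ be the transition operator of the jump process killed in $H$ and
  $q_k = T^k 1_{-H}$ its survival probabilities. Testing the equation against $q_k$ gives the
  hierarchy $F_k' = F_{k+1} - F_k$ for $F_k(t) = \int u(t) q_k$, so the mass $M(t)$ is the Poisson
  average, with mean $t$, of $a_k = \int u_0 q_k$. Since $T \phi = \phi$ and
  $\phi = \log |x| + O(1)$ off $H$, comparing $\phi$ with multiples of $1$ and applying $T^k$
  turns upper and lower bounds on $\log |x|$ into bounds on $a_k$.

  From above, $2 \log |x| \le |x|^2 / \mu - 1 + \log \mu$ and $T^k |x|^2 \le |x|^2 + \sigma^2 k$, with
  $\mu = t \log t$. From below, $\log |x| \ge \log r$ except on the slab $|x \cdot e| \le r$, whose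
  indicator is at most $2 |N^{-1} \sum_{m<N} e^{i m s x \cdot e}|^2$ if $N s r \le 1$. As $J *$ acts on
  $\cos (\xi x \cdot e)$ by multiplication with the Fourier transform of $J$, the image of this function
  under $T^k$ is bounded by $N^{-1} + (1 - c s^2)^k$, and $s = \log t / \sqrt t$,
  $N \approx \log^2 t$, $r = \sqrt t / (2 \log^3 t)$ make the error negligible. Both bounds on
  $M(t)$ are then asymptotic to $2 M_\phi^* / \log t$.
\<close>

section \<open>Convolution with the jump kernel\<close>

lemma borel_imp_lebesgue_measurable:
  fixes g :: "'a::euclidean_space \<Rightarrow> real"
  assumes "g \<in> borel_measurable borel"
  shows "g \<in> borel_measurable lebesgue"
proof (rule measurable_completion)
  show "g \<in> borel_measurable lborel" using assms by (simp only: measurable_lborel2)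
qed

lemma integral_lborel_reflect:
  fixes f :: "'a::euclidean_space \<Rightarrow> real"
  assumes [measurable]: "f \<in> borel_measurable borel"
  shows "(LINT y|lborel. f (x - y)) = (LINT y|lborel. f y)"
proof -
  have "distr lborel borel (\<lambda>y. x + (-1) *\<^sub>R y) = (lborel :: 'a measure)"
    using lborel_affine[of "-1" x] by (simp add: density_1)
  then have "(LINT y|lborel. f y) = (LINT y|distr lborel borel (\<lambda>y. x + (-1) *\<^sub>R y). f y)"
    by simp
  also have "\<dots> = (LINT y|lborel. f (x + (-1) *\<^sub>R y))"
    by (rule integral_distr) auto
  finally show ?thesis by simp
qed

text \<open>For \<open>g\<close> in this class \<open>J * g\<close> is defined at every point, since
  only a bounded neighbourhood of the point enters. The class contains the unbounded functions
  \<open>\<phi>\<close> and |x|^2 and is preserved by linear combinations, by restriction to a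
  measurable set and by convolution with \<open>J\<close>.\<close>

definition locally_bounded_measurable :: "('a::euclidean_space \<Rightarrow> real) \<Rightarrow> bool" where
  "locally_bounded_measurable g \<longleftrightarrow>
     g \<in> borel_measurable lebesgue \<and> (\<forall>K. compact K \<longrightarrow> bounded (g ` K))"

lemma locally_bounded_measurableI:
  assumes "g \<in> borel_measurable lebesgue" "\<And>r. \<exists>B. \<forall>x. norm x \<le> r \<longrightarrow> \<bar>g x\<bar> \<le> B"
  shows "locally_bounded_measurable g"
  unfolding locally_bounded_measurable_def
proof (intro conjI allI impI)
  fix K :: "'a set" assume "compact K"
  then obtain r where r: "\<forall>x\<in>K. norm x \<le> r" using compact_imp_bounded bounded_iff by blast
  obtain B where "\<forall>x. norm x \<le> r \<longrightarrow> \<bar>g x\<bar> \<le> B" using assms(2) by blast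
  with r show "bounded (g ` K)" unfolding bounded_iff by (intro exI[of _ B]) auto
qed (use assms in auto)

lemma locally_bounded_measurableD:
  assumes "locally_bounded_measurable g"
  shows "g \<in> borel_measurable lebesgue"
    and "\<And>r. \<exists>B\<ge>0. \<forall>x. norm x \<le> r \<longrightarrow> \<bar>g x\<bar> \<le> B"
proof -
  show "g \<in> borel_measurable lebesgue" using assms by (simp add: locally_bounded_measurable_def)
  fix r :: real
  have "bounded (g ` cball 0 r)"
    using assms by (simp add: locally_bounded_measurable_def)
  then obtain B where B: "\<forall>y\<in>g ` cball 0 r. norm y \<le> B" unfolding bounded_iff by (elim exE)
  have "\<bar>g x\<bar> \<le> max 0 B" if "norm x \<le> r" for x
  proof -
    have "norm (g x) \<le> B" using that B by simp
    then show ?thesis by simp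
  qed
  then show "\<exists>B\<ge>0. \<forall>x. norm x \<le> r \<longrightarrow> \<bar>g x\<bar> \<le> B"
    by (intro exI[of _ "max 0 B"] conjI) simp_all
qed

lemma locally_bounded_measurable_linear:
  assumes "locally_bounded_measurable f" "locally_bounded_measurable g"
  shows "locally_bounded_measurable (\<lambda>x. a * f x + b * g x)"
proof (rule locally_bounded_measurableI)
  show "(\<lambda>x. a * f x + b * g x) \<in> borel_measurable lebesgue"
    using assms[THEN locally_bounded_measurableD(1)] by measurable
  fix r
  obtain B C where B: "\<forall>x. norm x \<le> r \<longrightarrow> \<bar>f x\<bar> \<le> B" and C: "\<forall>x. norm x \<le> r \<longrightarrow> \<bar>g x\<bar> \<le> C"
    using assms[THEN locally_bounded_measurableD(2), of r] by blast
  have "\<bar>a * f x + b * g x\<bar> \<le> \<bar>a\<bar> * B + \<bar>b\<bar> * C" if "norm x \<le> r" for x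
    using mult_left_mono[of "\<bar>f x\<bar>" B "\<bar>a\<bar>"] mult_left_mono[of "\<bar>g x\<bar>" C "\<bar>b\<bar>"] B C that
      abs_triangle_ineq[of "a * f x" "b * g x"] by (simp add: abs_mult)
  then show "\<exists>B. \<forall>x. norm x \<le> r \<longrightarrow> \<bar>a * f x + b * g x\<bar> \<le> B" by auto
qed

lemma locally_bounded_measurable_continuous:
  assumes "continuous_on UNIV (g :: 'a::euclidean_space \<Rightarrow> real)"
  shows "locally_bounded_measurable g"
  unfolding locally_bounded_measurable_def
proof (intro conjI allI impI)
  show "g \<in> borel_measurable lebesgue"
    by (rule borel_imp_lebesgue_measurable[OF borel_measurable_continuous_onI[OF assms]])
  show "bounded (g ` K)" if "compact K" for K
    using continuous_on_subset[OF assms subset_UNIV] that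
    by (rule compact_imp_bounded[OF compact_continuous_image])
qed

lemma locally_bounded_measurable_restrict:
  assumes "locally_bounded_measurable g" "A \<in> sets lebesgue"
  shows "locally_bounded_measurable (\<lambda>x. if x \<in> A then 0 else g x)"
proof (rule locally_bounded_measurableI)
  show "(\<lambda>x. if x \<in> A then 0 else g x) \<in> borel_measurable lebesgue"
    using assms locally_bounded_measurableD(1)[OF assms(1)] by (intro measurable_If_set) auto
  fix r
  obtain B where "B \<ge> 0" "\<forall>x. norm x \<le> r \<longrightarrow> \<bar>g x\<bar> \<le> B"
    using locally_bounded_measurableD(2)[OF assms(1), of r] by blast
  then show "\<exists>B. \<forall>x. norm x \<le> r \<longrightarrow> \<bar>if x \<in> A then 0 else g x\<bar> \<le> B"
    by (intro exI[of _ B] allI impI) simp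
qed

locale jump_kernel =
  fixes J :: "'a::euclidean_space \<Rightarrow> real" and d :: real
  assumes continuous_J: "continuous_on UNIV J"
    and even_J: "J (- x) = J x"
    and J_nonneg: "J x \<ge> 0"
    and J_support: "norm x \<ge> d \<Longrightarrow> J x = 0"
    and J_mass: "(LINT x|lborel. J x) = 1"
    and d_pos: "d > 0"
begin

lemma borel_J [measurable]: "J \<in> borel_measurable borel"
  by (rule borel_measurable_continuous_onI[OF continuous_J])

lemma J_diff_commute: "J (x - y) = J (y - x)"
  using even_J[of "x - y"] by simp

lemma integrable_J_mult:
  assumes "continuous_on UNIV g"
  shows "integrable lborel (\<lambda>y. J y * g y :: real)"
proof -
  have "continuous_on (cball 0 d) (\<lambda>y. J y * g y)"
    by (intro continuous_on_mult continuous_on_subset[OF continuous_J] continuous_on_subset[OF assms]) auto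
  then have "integrable lborel (\<lambda>y. indicator (cball 0 d) y *\<^sub>R (J y * g y))"
    by (intro borel_integrable_compact) auto
  moreover have "indicator (cball 0 d) y *\<^sub>R (J y * g y) = J y * g y" for y
    using J_support[of y] by (auto simp: indicator_def)
  ultimately show ?thesis by (simp only:)
qed

lemma integrable_J: "integrable lborel J"
  using integrable_J_mult[of "\<lambda>_. 1"] by simp

lemma integrable_conv:
  assumes g: "locally_bounded_measurable g"
  shows "integrable lebesgue (\<lambda>y. J (x - y) * g y)"
proof -
  obtain B where B: "\<forall>y. norm y \<le> norm x + d \<longrightarrow> \<bar>g y\<bar> \<le> B"
    using locally_bounded_measurableD(2)[OF g, of "norm x + d"] by blast
  have "bounded (J ` cball 0 d)"
    by (intro compact_imp_bounded compact_continuous_image continuous_on_subset[OF continuous_J]) auto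
  then obtain C where C: "\<forall>y\<in>cball 0 d. \<bar>J y\<bar> \<le> C" by (auto simp: bounded_iff)
  have "(\<lambda>y. J (x - y)) \<in> borel_measurable lebesgue"
    by (intro borel_imp_lebesgue_measurable) measurable
  then have meas: "(\<lambda>y. J (x - y) * g y) \<in> borel_measurable lebesgue"
    using locally_bounded_measurableD(1)[OF g] by measurable
  show ?thesis
  proof (rule integrableI_bounded_set[where A="cball x d" and B="C * B"])
    show "AE y in lebesgue. y \<in> cball x d \<longrightarrow> norm (J (x - y) * g y) \<le> C * B"
    proof (intro AE_I2 impI)
      fix y assume "y \<in> cball x d"
      then have y: "norm (x - y) \<le> d" by (simp add: dist_norm)
      then have "norm y \<le> norm x + d" using norm_triangle_ineq2[of y x] by (simp add: norm_minus_commute)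
      then show "norm (J (x - y) * g y) \<le> C * B"
        using y B C by (auto simp: abs_mult intro!: mult_mono order_trans[OF abs_ge_zero])
    qed
    show "AE y in lebesgue. y \<notin> cball x d \<longrightarrow> J (x - y) * g y = 0"
      using J_support by (auto simp: dist_norm)
    show "emeasure lebesgue (cball x d) < \<infinity>"
      using lmeasurable_cball[of x d] by (simp add: fmeasurable_def)
  qed (use meas in auto)
qed

lemma conv_eq:
  assumes [measurable]: "g \<in> borel_measurable borel"
  shows "conv J g x = (LINT y|lborel. J y * g (x - y))"
proof -
  have "conv J g x = (LINT y|lborel. J (x - y) * g y)"
    unfolding conv_def by (rule integral_completion) measurable
  also have "\<dots> = (LINT y|lborel. J y * g (x - y))"
    using integral_lborel_reflect[of "\<lambda>y. J y * g (x - y)" x] by simp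
  finally show ?thesis .
qed

text \<open>Replacing \<open>g\<close> by a Borel function equal to it almost everywhere leaves the
  integral unchanged at every \<open>x\<close>, not only at almost every \<open>x\<close>. What
  remains is a parameter integral of a jointly Borel function.\<close>

lemma borel_conv:
  assumes g: "g \<in> borel_measurable lebesgue"
  shows "conv J g \<in> borel_measurable borel"
proof -
  obtain g' where g'[measurable]: "g' \<in> borel_measurable borel" and eq: "AE x in lborel. g x = g' x"
    using completion_ex_borel_measurable_real[of g lborel] g by auto
  have "conv J g x = (LINT y|lborel. J (x - y) * g' y)" for x
  proof -
    have "(\<lambda>y. J (x - y)) \<in> borel_measurable lebesgue"
      by (intro borel_imp_lebesgue_measurable) measurable
    moreover have "g' \<in> borel_measurable lebesgue" by (intro borel_imp_lebesgue_measurable) measurable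
    ultimately have "conv J g x = (LINT y|lebesgue. J (x - y) * g' y)"
      unfolding conv_def using g eq[THEN AE_completion]
      by (intro integral_cong_AE borel_measurable_times) (auto elim!: eventually_mono)
    also have "\<dots> = (LINT y|lborel. J (x - y) * g' y)"
      by (rule integral_completion) measurable
    finally show ?thesis .
  qed
  then have "conv J g = (\<lambda>x. LINT y|lborel. J (x - y) * g' y)" by blast
  then show ?thesis by simp
qed

lemma conv_mono:
  assumes "locally_bounded_measurable f" "locally_bounded_measurable g" "AE x in lebesgue. f x \<le> g x"
  shows "conv J f x \<le> conv J g x"
  unfolding conv_def using assms
  by (intro integral_mono_AE integrable_conv) (auto elim!: eventually_mono simp: J_nonneg mult_left_mono)

lemma conv_linear:
  assumes "locally_bounded_measurable f" "locally_bounded_measurable g"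
  shows "conv J (\<lambda>x. a * f x + b * g x) x = a * conv J f x + b * conv J g x"
proof -
  have "conv J (\<lambda>x. a * f x + b * g x) x
      = (LINT y|lebesgue. a * (J (x - y) * f y) + b * (J (x - y) * g y))"
    unfolding conv_def by (intro Bochner_Integration.integral_cong) (auto simp: algebra_simps)
  also have "\<dots> = a * conv J f x + b * conv J g x"
    unfolding conv_def using assms[THEN integrable_conv]
    by (subst Bochner_Integration.integral_add) auto
  finally show ?thesis .
qed

lemma conv_const: "conv J (\<lambda>_. c) x = c"
  using J_mass by (simp add: conv_eq)

text \<open>On the ball of radius \<open>r\<close> the convolution sees only the values of
  \<open>g\<close> on the ball of radius \<open>r + d\<close>, and averaging against a probability
  density does not increase a bound.\<close>

lemma locally_bounded_measurable_conv:
  assumes g: "locally_bounded_measurable g"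
  shows "locally_bounded_measurable (conv J g)"
proof (rule locally_bounded_measurableI)
  show "conv J g \<in> borel_measurable lebesgue"
    by (intro borel_imp_lebesgue_measurable borel_conv locally_bounded_measurableD(1)[OF g])
  fix r
  obtain B where B: "B \<ge> 0" "\<forall>x. norm x \<le> r + d \<longrightarrow> \<bar>g x\<bar> \<le> B"
    using locally_bounded_measurableD(2)[OF g, of "r + d"] by blast
  have "\<bar>conv J g x\<bar> \<le> B" if "norm x \<le> r" for x
  proof -
    have *: "J (x - y) * \<bar>g y\<bar> \<le> J (x - y) * B" for y
    proof (cases "norm (x - y) < d")
      case True
      then have "norm y \<le> r + d"
        using norm_triangle_ineq2[of y x] that by (simp add: norm_minus_commute)
      then show ?thesis using B J_nonneg by (simp add: mult_left_mono)
    qed (simp add: J_support)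
    have "\<bar>conv J g x\<bar> \<le> (LINT y|lebesgue. \<bar>J (x - y) * g y\<bar>)"
      unfolding conv_def by (rule integral_abs_bound)
    also have "\<dots> \<le> (LINT y|lebesgue. J (x - y) * B)"
      using * J_nonneg locally_bounded_measurable_continuous[of "\<lambda>_. B"]
      by (intro integral_mono integrable_abs integrable_conv g) (auto simp: abs_mult)
    also have "\<dots> = B" using conv_const[of B x] unfolding conv_def .
    finally show ?thesis .
  qed
  then show "\<exists>B. \<forall>x. norm x \<le> r \<longrightarrow> \<bar>conv J g x\<bar> \<le> B" by auto
qed

lemma conv_nonneg:
  assumes "\<And>x. g x \<ge> 0"
  shows "conv J g x \<ge> 0"
  unfolding conv_def using assms J_nonneg by (intro integral_nonneg_AE) simp

lemma integral_J_inner: "(LINT y|lborel. J y * (z \<bullet> y)) = 0"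
proof -
  have "(LINT y|lborel. J y * (z \<bullet> y)) = (LINT y|lborel. J (0 - y) * (z \<bullet> (0 - y)))"
    by (rule integral_lborel_reflect[symmetric]) measurable
  also have "\<dots> = - (LINT y|lborel. J y * (z \<bullet> y))"
    by (simp add: even_J)
  finally show ?thesis by simp
qed

text \<open>In the expansion of |x - y|^2 the cross term integrates to zero because \<open>J\<close>
  is even. One convolution step therefore adds exactly the second moment of
  \<open>J\<close>.\<close>

lemma conv_norm_squared:
  "conv J (\<lambda>x. (norm x)\<^sup>2) x = (norm x)\<^sup>2 + (LINT y|lborel. J y * (norm y)\<^sup>2)"
proof -
  have "conv J (\<lambda>x. (norm x)\<^sup>2) x = (LINT y|lborel. J y * (norm (x - y))\<^sup>2)"
    by (rule conv_eq) measurable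
  also have "\<dots> = (LINT y|lborel. (norm x)\<^sup>2 * J y + J y * (norm y)\<^sup>2 - 2 * (J y * (x \<bullet> y)))"
    by (intro Bochner_Integration.integral_cong)
       (auto simp: power2_norm_eq_inner algebra_simps inner_commute)
  also have "\<dots> = (norm x)\<^sup>2 + (LINT y|lborel. J y * (norm y)\<^sup>2)"
    using integrable_J integrable_J_mult[of "\<lambda>y. (norm y)\<^sup>2"] integrable_J_mult[of "\<lambda>y. x \<bullet> y"]
    by (simp add: J_mass integral_J_inner continuous_intros)
  finally show ?thesis .
qed

text \<open>The addition formula for cos(a - b) leaves a cosine and a sine integral, and the latter
  vanishes because \<open>J\<close> is even. So the plane wave is an eigenfunction of the
  convolution.\<close>

lemma conv_cos:
  "conv J (\<lambda>x. cos (\<xi> * (x \<bullet> e))) x = (LINT y|lborel. J y * cos (\<xi> * (y \<bullet> e))) * cos (\<xi> * (x \<bullet> e))"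
proof -
  let ?s = "\<lambda>y. J y * sin (\<xi> * (y \<bullet> e))" and ?c = "\<lambda>y. J y * cos (\<xi> * (y \<bullet> e))"
  have "(LINT y|lborel. ?s y) = (LINT y|lborel. ?s (0 - y))"
    by (rule integral_lborel_reflect[symmetric]) measurable
  also have "\<dots> = - (LINT y|lborel. ?s y)"
    by (simp add: even_J)
  finally have odd: "(LINT y|lborel. ?s y) = 0" by simp
  have "conv J (\<lambda>x. cos (\<xi> * (x \<bullet> e))) x = (LINT y|lborel. J y * cos (\<xi> * ((x - y) \<bullet> e)))"
    by (rule conv_eq) measurable
  also have "\<dots> = (LINT y|lborel. cos (\<xi> * (x \<bullet> e)) * ?c y + sin (\<xi> * (x \<bullet> e)) * ?s y)"
    by (intro Bochner_Integration.integral_cong)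
       (auto simp: inner_diff_left right_diff_distrib cos_diff algebra_simps)
  also have "\<dots> = cos (\<xi> * (x \<bullet> e)) * (LINT y|lborel. ?c y)"
    using integrable_J_mult[of "\<lambda>y. cos (\<xi> * (y \<bullet> e))"] integrable_J_mult[of "\<lambda>y. sin (\<xi> * (y \<bullet> e))"]
    by (simp add: odd continuous_intros)
  finally show ?thesis by simp
qed

end

section \<open>The killed operator\<close>

locale killed_jump = jump_kernel J d for J :: "'a::euclidean_space \<Rightarrow> real" and d +
  fixes H :: "'a set"
  assumes borel_H [measurable]: "H \<in> sets borel"
begin

definition killed_conv :: "('a \<Rightarrow> real) \<Rightarrow> 'a \<Rightarrow> real" where
  "killed_conv g x = (if x \<in> H then 0 else conv J g x)"

text \<open>The value at \<open>x\<close> is the probability that the random walk from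
  \<open>x\<close> with step density \<open>J\<close> is outside \<open>H\<close> at all times 0,
  ..., \<open>k\<close>.\<close>

definition survival :: "nat \<Rightarrow> 'a \<Rightarrow> real" where
  "survival k = (killed_conv ^^ k) (\<lambda>x. if x \<in> H then 0 else 1)"

lemma killed_conv_Suc:
  "(killed_conv ^^ Suc k) g x = (if x \<in> H then 0 else conv J ((killed_conv ^^ k) g) x)"
  unfolding funpow.simps comp_def by (rule killed_conv_def)

lemma lebesgue_H: "H \<in> sets lebesgue"
  using borel_H by simp

lemma locally_bounded_measurable_killed_conv:
  assumes "locally_bounded_measurable g"
  shows "locally_bounded_measurable ((killed_conv ^^ k) g)"
proof (induction k)
  case (Suc k)
  show ?case
    using locally_bounded_measurable_restrict[OF locally_bounded_measurable_conv[OF Suc] lebesgue_H]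
    by (simp only: killed_conv_Suc[abs_def])
qed (simp add: assms)

text \<open>An inequality almost everywhere is the right hypothesis because \<open>\<phi>\<close> is
  compared with the logarithm only up to null sets. A single convolution already makes it hold
  everywhere, but the case \<open>k = 0\<close> does not.\<close>

lemma killed_conv_mono:
  assumes "locally_bounded_measurable f" "locally_bounded_measurable g" "AE x in lebesgue. f x \<le> g x"
  shows "AE x in lebesgue. (killed_conv ^^ k) f x \<le> (killed_conv ^^ k) g x"
proof (induction k)
  case (Suc k)
  show ?case
    using conv_mono[OF assms(1,2)[THEN locally_bounded_measurable_killed_conv] Suc]
    by (simp add: killed_conv_def)
qed (simp add: assms)

lemma killed_conv_linear:
  assumes "locally_bounded_measurable f" "locally_bounded_measurable g"
  shows "(killed_conv ^^ k) (\<lambda>x. a * f x + b * g x)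
    = (\<lambda>x. a * (killed_conv ^^ k) f x + b * (killed_conv ^^ k) g x)"
proof (induction k)
  case (Suc k)
  show ?case
    unfolding funpow.simps comp_def Suc
    using conv_linear[OF assms[THEN locally_bounded_measurable_killed_conv], of a k b k]
    by (auto simp: killed_conv_def fun_eq_iff)
qed simp

lemma locally_bounded_measurable_alive:
  assumes "continuous_on UNIV g"
  shows "locally_bounded_measurable (\<lambda>x. if x \<in> H then 0 else g x)"
  using locally_bounded_measurable_restrict[OF locally_bounded_measurable_continuous[OF assms] lebesgue_H] .

lemma locally_bounded_measurable_survival: "locally_bounded_measurable (survival k)"
  unfolding survival_def
  by (intro locally_bounded_measurable_killed_conv locally_bounded_measurable_alive) auto

lemma survival_Suc: "survival (Suc k) x = (if x \<in> H then 0 else conv J (survival k) x)"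
  by (simp add: survival_def killed_conv_def)

lemma survival_hole: "x \<in> H \<Longrightarrow> survival k x = 0"
  by (cases k) (auto simp: survival_Suc, simp add: survival_def)

lemma survival_nonneg: "0 \<le> survival k x"
proof (induction k arbitrary: x)
  case (Suc k) then show ?case by (simp add: survival_Suc conv_nonneg)
qed (simp add: survival_def)

lemma survival_le_1: "survival k x \<le> 1"
proof (induction k arbitrary: x)
  case (Suc k)
  have "conv J (survival k) x \<le> conv J (\<lambda>_. 1) x"
    using Suc by (intro conv_mono locally_bounded_measurable_survival locally_bounded_measurable_continuous) auto
  then show ?case by (simp add: survival_Suc conv_const)
qed (simp add: survival_def)

lemma borel_survival: "survival k \<in> borel_measurable borel"
proof (cases k)
  case 0
  then show ?thesis by (simp add: survival_def)
next
  case (Suc m)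
  have [measurable]: "conv J (survival m) \<in> borel_measurable borel"
    using borel_conv locally_bounded_measurableD(1)[OF locally_bounded_measurable_survival] by blast
  show ?thesis unfolding Suc survival_Suc[abs_def] by measurable
qed

text \<open>Each step adds the second moment of \<open>J\<close> by
  \<open>conv_norm_squared\<close>, and killing can only lower the value since the right-hand side
  is nonnegative.\<close>

lemma killed_conv_norm_squared_le:
  "(killed_conv ^^ k) (\<lambda>x. if x \<in> H then 0 else (norm x)\<^sup>2) x
     \<le> (norm x)\<^sup>2 + (LINT y|lborel. J y * (norm y)\<^sup>2) * real k"
    (is "(_ ^^ _) ?w _ \<le> _ + ?V * _")
proof (induction k arbitrary: x)
  case (Suc k)
  have V: "?V \<ge> 0" using J_nonneg by (intro integral_nonneg_AE) simp
  \<comment> \<open>The factors \<open>1\<close> bring the induction hypothesis into the form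
    \<open>a * f x + b * g x\<close> that \<open>conv_linear\<close> expects.\<close>
  have "conv J ((killed_conv ^^ k) ?w) x \<le> conv J (\<lambda>x. 1 * (norm x)\<^sup>2 + (?V * real k) * 1) x"
    using Suc
    by (intro conv_mono locally_bounded_measurable_killed_conv locally_bounded_measurable_alive
        locally_bounded_measurable_continuous AE_I2) (auto intro!: continuous_intros)
  also have "\<dots> = (norm x)\<^sup>2 + ?V + ?V * real k"
    by (subst conv_linear) (auto intro!: locally_bounded_measurable_continuous continuous_intros
        simp: conv_const conv_norm_squared)
  finally show ?case using V by (simp add: killed_conv_Suc algebra_simps del: funpow.simps)
qed simp

text \<open>Killing only loses mass for nonnegative functions, so estimates may be made for the free
  walk, where Fourier analysis applies. The three claims are proved together because the step for
  the first uses the sign and the regularity of the free iterates.\<close>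

lemma killed_conv_le_conv:
  assumes "locally_bounded_measurable g" "\<And>x. g x \<ge> 0"
  shows "(killed_conv ^^ k) g x \<le> (conv J ^^ k) g x" "0 \<le> (conv J ^^ k) g x"
    "locally_bounded_measurable ((conv J ^^ k) g)"
proof (induction k arbitrary: x)
  case (Suc k)
  { case 1
    have "conv J ((killed_conv ^^ k) g) x \<le> conv J ((conv J ^^ k) g) x"
      using Suc by (intro conv_mono locally_bounded_measurable_killed_conv assms AE_I2)
    moreover have "0 \<le> conv J ((conv J ^^ k) g) x" using Suc(2) by (rule conv_nonneg)
    ultimately show ?case unfolding killed_conv_Suc by simp
  next
    case 2
    then show ?case using Suc(2) by (simp add: conv_nonneg)
  next
    case 3
    then show ?case using locally_bounded_measurable_conv[OF Suc(3)] by simp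
  }
qed (use assms in auto)

end

section \<open>Concentration via cosine sums\<close>

text \<open>The lower bound comes from 1 < pi/3. Fed into the second-order Lagrange remainder, it
  yields the quadratic upper bound.\<close>

lemma cos_bounds_unit:
  fixes \<theta> :: real
  assumes "\<bar>\<theta>\<bar> \<le> 1"
  shows "1 / 2 \<le> cos \<theta>" "cos \<theta> \<le> 1 - \<theta>\<^sup>2 / 4"
proof -
  have half: "1 / 2 \<le> cos t" if "0 \<le> t" "t \<le> 1" for t :: real
    using cos_monotone_0_pi_le[of t "pi / 3"] that pi_gt3 by (simp add: cos_60)
  show "1 / 2 \<le> cos \<theta>" using half[of "\<bar>\<theta>\<bar>"] assms by simp
  show "cos \<theta> \<le> 1 - \<theta>\<^sup>2 / 4"
  proof (cases "\<theta> = 0")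
    case False
    then obtain t where t: "0 < t" "t < \<bar>\<theta>\<bar>"
      and eq: "cos \<bar>\<theta>\<bar> = (\<Sum>m<2. cos_coeff m * \<bar>\<theta>\<bar> ^ m) + cos (t + 1 / 2 * real 2 * pi) / fact 2 * \<bar>\<theta>\<bar> ^ 2"
      using Maclaurin_cos_expansion2[of "\<bar>\<theta>\<bar>" 2] by auto
    \<comment> \<open>The remainder contains cos(t + pi) = - cos t.\<close>
    have "cos \<theta> = 1 - cos t / 2 * \<theta>\<^sup>2"
      using eq by (simp add: numeral_2_eq_2 cos_coeff_def)
    moreover have "1 / 4 * \<theta>\<^sup>2 \<le> cos t / 2 * \<theta>\<^sup>2"
      using half[of t] t assms by (intro mult_right_mono) auto
    ultimately show ?thesis by simp
  qed simp
qed

text \<open>This is the squared modulus of the exponential mean $N^{-1} \sum_{m<N} e^{i m a}$.\<close>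
definition cosine_mean :: "nat \<Rightarrow> real \<Rightarrow> real" where
  "cosine_mean N a = (\<Sum>p\<in>{..<N} \<times> {..<N}. 1 / (real N)\<^sup>2 * cos ((real (fst p) - real (snd p)) * a))"

text \<open>Expanding cos((i - j)a) separates the double sum into the squares of the real and
  imaginary parts of the exponential sum.\<close>

lemma cosine_mean_nonneg: "0 \<le> cosine_mean N a"
proof -
  have "cosine_mean N a = 1 / (real N)\<^sup>2 *
      (\<Sum>i<N. \<Sum>j<N. cos (real i * a) * cos (real j * a) + sin (real i * a) * sin (real j * a))"
    unfolding cosine_mean_def
    by (simp add: sum.cartesian_product sum_distrib_left left_diff_distrib cos_diff case_prod_beta)
  also have "\<dots> = 1 / (real N)\<^sup>2 * ((\<Sum>i<N. cos (real i * a))\<^sup>2 + (\<Sum>i<N. sin (real i * a))\<^sup>2)"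
    by (simp add: sum.distrib sum_product power2_eq_square)
  finally show ?thesis by simp
qed

text \<open>All angles (i - j)a lie in [-1, 1], so every cosine in the average is at least 1/2.
  Twice the mean thus dominates the indicator of a slab.\<close>

lemma cosine_mean_ge_half:
  assumes "N > 0" "real N * \<bar>a\<bar> \<le> 1"
  shows "1 / 2 \<le> cosine_mean N a"
proof -
  have "1 / 2 = (\<Sum>p\<in>{..<N} \<times> {..<N}. 1 / (real N)\<^sup>2 * (1 / 2))"
    using assms by (simp add: power2_eq_square)
  also have "\<dots> \<le> cosine_mean N a"
    unfolding cosine_mean_def
  proof (intro sum_mono mult_left_mono)
    fix p assume "p \<in> {..<N} \<times> {..<N}"
    then have "\<bar>real (fst p) - real (snd p)\<bar> \<le> real N" by auto
    then have "\<bar>(real (fst p) - real (snd p)) * a\<bar> \<le> real N * \<bar>a\<bar>"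
      by (simp add: abs_mult mult_right_mono)
    then show "1 / 2 \<le> cos ((real (fst p) - real (snd p)) * a)"
      using assms by (intro cos_bounds_unit) auto
  qed simp
  finally show ?thesis .
qed

section \<open>The Fourier transform of \<open>J\<close> and the decay of cosine sums\<close>

context jump_kernel
begin

text \<open>This is the Fourier transform of \<open>J\<close> at the frequency \<open>\<xi>\<close>
  in direction \<open>e\<close>; it is real because \<open>J\<close> is even.\<close>

definition char_fun :: "'a \<Rightarrow> real \<Rightarrow> real" where
  "char_fun e \<xi> = (LINT y|lborel. J y * cos (\<xi> * (y \<bullet> e)))"

lemma conv_sum:
  assumes "\<And>i. i \<in> I \<Longrightarrow> locally_bounded_measurable (f i)"
  shows "conv J (\<lambda>x. \<Sum>i\<in>I. a i * f i x) x = (\<Sum>i\<in>I. a i * conv J (f i) x)"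
proof -
  have "conv J (\<lambda>x. \<Sum>i\<in>I. a i * f i x) x = (LINT y|lebesgue. (\<Sum>i\<in>I. a i * (J (x - y) * f i y)))"
    unfolding conv_def sum_distrib_left
    by (intro Bochner_Integration.integral_cong sum.cong) auto
  also have "\<dots> = (\<Sum>i\<in>I. a i * conv J (f i) x)"
    unfolding conv_def using integrable_conv[OF assms] by (subst Bochner_Integration.integral_sum) auto
  finally show ?thesis .
qed

lemma conv_power_trig_sum:
  "(conv J ^^ k) (\<lambda>x. \<Sum>i\<in>I. a i * cos (\<xi> i * (x \<bullet> e)))
    = (\<lambda>x. \<Sum>i\<in>I. (a i * char_fun e (\<xi> i) ^ k) * cos (\<xi> i * (x \<bullet> e)))"
proof (induction k)
  case (Suc k)
  show ?case
    unfolding funpow.simps comp_def Suc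
    by (rule ext, subst conv_sum)
       (auto intro!: locally_bounded_measurable_continuous continuous_intros
         simp: conv_cos char_fun_def algebra_simps)
qed simp

text \<open>The condition on \<open>\<xi>\<close> keeps the angle in [-1, 1] on the support of
  \<open>J\<close>, so \<open>cos_bounds_unit\<close> can be integrated against \<open>J\<close>.
  Nonnegativity is what later allows an upper bound to be raised to a power.\<close>

lemma char_fun_bounds:
  assumes "norm e = 1" "\<bar>\<xi>\<bar> * d \<le> 1"
  shows "0 \<le> char_fun e \<xi>" "char_fun e \<xi> \<le> 1 - \<xi>\<^sup>2 / 4 * (LINT y|lborel. J y * (y \<bullet> e)\<^sup>2)"
proof -
  have small: "\<bar>\<xi> * (y \<bullet> e)\<bar> \<le> 1" if "norm y < d" for y
  proof -
    have "\<bar>y \<bullet> e\<bar> \<le> d" using Cauchy_Schwarz_ineq2[of y e] assms(1) that by simp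
    then have "\<bar>\<xi>\<bar> * \<bar>y \<bullet> e\<bar> \<le> \<bar>\<xi>\<bar> * d" by (intro mult_left_mono) auto
    then show ?thesis using assms(2) by (simp add: abs_mult)
  qed
  have "0 \<le> J y * cos (\<xi> * (y \<bullet> e))" for y
    using cos_bounds_unit(1)[OF small, of y] J_nonneg[of y] J_support[of y]
    by (cases "norm y < d") auto
  then show "0 \<le> char_fun e \<xi>"
    unfolding char_fun_def by (intro integral_nonneg_AE) simp
  have int: "integrable lborel (\<lambda>y. J y * (y \<bullet> e)\<^sup>2)"
    by (intro integrable_J_mult continuous_intros)
  have "J y * cos (\<xi> * (y \<bullet> e)) \<le> J y - \<xi>\<^sup>2 / 4 * (J y * (y \<bullet> e)\<^sup>2)" for y
  proof (cases "norm y < d")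
    case True
    have "J y * cos (\<xi> * (y \<bullet> e)) \<le> J y * (1 - (\<xi> * (y \<bullet> e))\<^sup>2 / 4)"
      by (intro mult_left_mono cos_bounds_unit small True J_nonneg)
    then show ?thesis by (simp add: algebra_simps power_mult_distrib)
  qed (simp add: J_support)
  then have "char_fun e \<xi> \<le> (LINT y|lborel. J y - \<xi>\<^sup>2 / 4 * (J y * (y \<bullet> e)\<^sup>2))"
    unfolding char_fun_def
    by (intro integral_mono integrable_J_mult Bochner_Integration.integrable_diff integrable_J integrable_mult_right int continuous_intros) auto
  also have "\<dots> = 1 - \<xi>\<^sup>2 / 4 * (LINT y|lborel. J y * (y \<bullet> e)\<^sup>2)"
    using int integrable_J by (simp add: J_mass)
  finally show "char_fun e \<xi> \<le> 1 - \<xi>\<^sup>2 / 4 * (LINT y|lborel. J y * (y \<bullet> e)\<^sup>2)" .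
qed

text \<open>If the integral vanished, \<open>J\<close> would be zero almost everywhere off the
  hyperplane orthogonal to \<open>e\<close>, hence almost everywhere, contradicting its mass
  1.\<close>

lemma directional_variance_pos:
  assumes "norm e = 1"
  shows "0 < (LINT y|lborel. J y * (y \<bullet> e)\<^sup>2)"
proof (rule ccontr)
  assume "\<not> ?thesis"
  moreover have nn: "AE y in lborel. 0 \<le> J y * (y \<bullet> e)\<^sup>2" by (simp add: J_nonneg)
  ultimately have "(LINT y|lborel. J y * (y \<bullet> e)\<^sup>2) = 0"
    using integral_nonneg_AE[OF nn] by simp
  then have "AE y in lborel. J y * (y \<bullet> e)\<^sup>2 = 0"
    using integral_nonneg_eq_0_iff_AE[OF _ nn] integrable_J_mult[of "\<lambda>y. (y \<bullet> e)\<^sup>2"]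
    by (simp add: continuous_intros)
  moreover have "AE y in lborel. y \<bullet> e \<noteq> 0"
  proof -
    have "negligible {y. e \<bullet> y = 0}" using assms by (intro negligible_hyperplane) auto
    then have "{y. e \<bullet> y = 0} \<in> null_sets lborel"
      using negligible_iff_null_sets null_sets_completion_iff[of "{y. e \<bullet> y = 0}" lborel] by (auto simp: closed_hyperplane)
    from AE_not_in[OF this] show ?thesis by (simp add: inner_commute)
  qed
  ultimately have "AE y in lborel. J y = 0" by eventually_elim auto
  then have "(LINT y|lborel. J y) = 0" by (subst integral_cong_AE[where g="\<lambda>_. 0"]) auto
  then show False using J_mass by simp
qed

text \<open>Of the N^2 pairs, the N diagonal ones have frequency zero and do not decay; they
  contribute 1/N. All others have frequency at least \<open>s\<close> in modulus, so their
  eigenvalue is at most 1 - s^2 v / 4, where v is the variance of \<open>J\<close> along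
  \<open>e\<close>.\<close>

lemma conv_power_cosine_mean_le:
  assumes e: "norm e = 1" and N: "N > 0" and s: "s > 0" "real N * s * d \<le> 1"
  shows "(conv J ^^ k) (\<lambda>x. cosine_mean N (s * (x \<bullet> e))) x
    \<le> 1 / real N + (1 - s\<^sup>2 / 4 * (LINT y|lborel. J y * (y \<bullet> e)\<^sup>2)) ^ k"
proof -
  define v where "v = (LINT y|lborel. J y * (y \<bullet> e)\<^sup>2)"
  define \<xi> where "\<xi> p = (real (fst p) - real (snd p)) * s" for p :: "nat \<times> nat"
  let ?I = "{..<N} \<times> {..<N}"
  have v: "v > 0" unfolding v_def by (rule directional_variance_pos[OF e])
  have "1 * (s * d) \<le> real N * (s * d)" using N s d_pos by (intro mult_right_mono) auto
  then have "s * d \<le> 1" using s(2) unfolding mult.assoc mult_1 by (rule order_trans)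
  then have "\<bar>s\<bar> * d \<le> 1" using s(1) by simp
  \<comment> \<open>The sign allows the geometric term to be added to the diagonal summands as well,
    which gives one bound for all pairs.\<close>
  from char_fun_bounds[OF e this] have rho: "0 \<le> 1 - s\<^sup>2 / 4 * v"
    unfolding v_def by linarith
  have summand_le: "char_fun e (\<xi> p) ^ k * cos (\<xi> p * (x \<bullet> e)) \<le> (if fst p = snd p then 1 else 0) + (1 - s\<^sup>2 / 4 * v) ^ k"
    if p: "p \<in> ?I" for p
  proof -
    have "\<bar>real (fst p) - real (snd p)\<bar> \<le> real N" using p by auto
    then have "\<bar>real (fst p) - real (snd p)\<bar> * (s * d) \<le> real N * (s * d)"
      using s d_pos by (intro mult_right_mono) auto
    also have "\<dots> \<le> 1" using s(2) by (simp only: mult.assoc)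
    finally have "\<bar>\<xi> p\<bar> * d \<le> 1" using s(1) by (simp add: \<xi>_def abs_mult mult.assoc)
    note cf = char_fun_bounds[OF e this]
    have "char_fun e (\<xi> p) ^ k * cos (\<xi> p * (x \<bullet> e)) \<le> char_fun e (\<xi> p) ^ k * 1"
      using cf by (intro mult_left_mono) auto
    also have "\<dots> \<le> (if fst p = snd p then 1 else 0) + (1 - s\<^sup>2 / 4 * v) ^ k"
    proof (cases "fst p = snd p")
      case True
      have "0 \<le> (\<xi> p)\<^sup>2 / 4 * v" using v by simp
      then have "char_fun e (\<xi> p) \<le> 1" using cf(2) unfolding v_def by linarith
      then have "char_fun e (\<xi> p) ^ k \<le> 1" using cf(1) by (intro power_le_one)
      then show ?thesis using True rho by (simp add: add_increasing2)
    next
      case False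
      then have "1 \<le> \<bar>real (fst p) - real (snd p)\<bar>" by linarith
      then have "1 * s \<le> \<bar>\<xi> p\<bar>" using s unfolding \<xi>_def abs_mult by (intro mult_mono) auto
      then have "s\<^sup>2 \<le> (\<xi> p)\<^sup>2" using s by (metis abs_le_square_iff abs_of_pos mult_1)
      then have "s\<^sup>2 / 4 * v \<le> (\<xi> p)\<^sup>2 / 4 * v" using v by (intro mult_right_mono) auto
      then have "char_fun e (\<xi> p) \<le> 1 - s\<^sup>2 / 4 * v"
        using cf(2) unfolding v_def by linarith
      then show ?thesis using False power_mono[OF _ cf(1)] by simp
    qed
    finally show ?thesis .
  qed
  have "(\<Sum>p\<in>?I. if fst p = snd p then 1 else 0 :: real) = (\<Sum>i<N. \<Sum>j<N. if i = j then 1 else 0)"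
    unfolding sum.cartesian_product by (intro sum.cong) auto
  then have diagonal: "(\<Sum>p\<in>?I. if fst p = snd p then 1 else 0 :: real) = real N" by simp
  have "(conv J ^^ k) (\<lambda>x. cosine_mean N (s * (x \<bullet> e))) x
      = (\<Sum>p\<in>?I. 1 / (real N)\<^sup>2 * (char_fun e (\<xi> p) ^ k * cos (\<xi> p * (x \<bullet> e))))"
    unfolding cosine_mean_def using conv_power_trig_sum[of k "\<lambda>_. 1 / (real N)\<^sup>2" \<xi> e ?I]
    by (simp add: \<xi>_def mult.assoc)
  also have "\<dots> \<le> (\<Sum>p\<in>?I. 1 / (real N)\<^sup>2 * ((if fst p = snd p then 1 else 0) + (1 - s\<^sup>2 / 4 * v) ^ k))"
    by (intro sum_mono mult_left_mono summand_le) auto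
  also have "\<dots> = 1 / (real N)\<^sup>2 * (real N + (real N)\<^sup>2 * (1 - s\<^sup>2 / 4 * v) ^ k)"
    unfolding sum_distrib_left[symmetric] sum.distrib diagonal by (simp add: power2_eq_square)
  also have "\<dots> = 1 / real N + (1 - s\<^sup>2 / 4 * v) ^ k"
    using N by (simp add: field_simps power2_eq_square)
  finally show "(conv J ^^ k) (\<lambda>x. cosine_mean N (s * (x \<bullet> e))) x
    \<le> 1 / real N + (1 - s\<^sup>2 / 4 * (LINT y|lborel. J y * (y \<bullet> e)\<^sup>2)) ^ k" by (simp add: v_def)
qed

end

section \<open>Poisson averages and duality\<close>

text \<open>This is the Taylor expansion of the semigroup e^{t(S - 1)}, with S the shift in
  \<open>k\<close>, evaluated on the sequence \<open>F\<close>. The bound \<open>C\<close> is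
  uniform in \<open>k\<close>, which makes the remainder vanish.\<close>

lemma poisson_hierarchy_sums:
  fixes F :: "nat \<Rightarrow> real \<Rightarrow> real"
  assumes t: "0 < t"
    and cont: "\<And>k. continuous_on {0..t} (F k)"
    and deriv: "\<And>k s. 0 < s \<Longrightarrow> s < t \<Longrightarrow> (F k has_real_derivative F (Suc k) s - F k s) (at s)"
    and bound: "\<And>k s. 0 \<le> s \<Longrightarrow> s \<le> t \<Longrightarrow> \<bar>F k s\<bar> \<le> C"
  shows "(\<lambda>k. exp (- t) * t ^ k / fact k * F k 0) sums F 0 t"
proof -
  \<comment> \<open>This interpolates between the partial sum of the series at s = 0 and e^t F_0(t)
    at s = t. Its derivative telescopes, leaving only the term with the highest index.\<close>
  define h where "h n s = exp s * (\<Sum>k<n. (t - s) ^ k / fact k * F k s)" for n s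
  have h_deriv: "(h (Suc n) has_real_derivative exp s * (t - s) ^ n / fact n * F (Suc n) s) (at s)"
    if s: "0 < s" "s < t" for n s
  proof (induction n)
    case 0
    have "h (Suc 0) = (\<lambda>s. exp s * F 0 s)" by (simp add: h_def fun_eq_iff)
    then show ?case
      by (auto intro!: derivative_eq_intros deriv s simp: algebra_simps)
  next
    case (Suc n)
    have h_Suc: "h (Suc (Suc n)) = (\<lambda>s. h (Suc n) s + exp s * ((t - s) ^ Suc n / fact (Suc n) * F (Suc n) s))"
      by (simp add: h_def fun_eq_iff algebra_simps)
    have pow: "((\<lambda>s. (t - s) ^ Suc n / fact (Suc n)) has_real_derivative - ((t - s) ^ n / fact n)) (at s)"
    proof -
      have "((\<lambda>s. (t - s) ^ Suc n) has_real_derivative - (real (Suc n) * (t - s) ^ n)) (at s)"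
        by (auto intro!: derivative_eq_intros simp del: power_Suc of_nat_Suc)
      from DERIV_cdivide[OF this, of "fact (Suc n)"]
      have "((\<lambda>s. (t - s) ^ Suc n / fact (Suc n)) has_real_derivative
          - (real (Suc n) * (t - s) ^ n) / (real (Suc n) * fact n)) (at s)"
        by (simp only: fact_Suc of_nat_mult of_nat_fact)
      moreover have "- (real (Suc n) * (t - s) ^ n) / (real (Suc n) * fact n) = - ((t - s) ^ n / fact n)"
        by (simp del: of_nat_Suc)
      ultimately show ?thesis by (simp only:)
    qed
    show ?case unfolding h_Suc
      by (rule DERIV_cong[OF DERIV_add[OF Suc DERIV_mult[OF DERIV_exp DERIV_mult[OF pow deriv[OF s, of "Suc n"]]]]])
         (simp add: algebra_simps diff_divide_distrib del: power_Suc fact_Suc)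
  qed
  \<comment> \<open>The mean value theorem turns the single remaining term of the derivative into
    the remainder estimate; it needs only continuity at the endpoints 0 and t.\<close>
  have bd: "\<bar>exp t * F 0 t - (\<Sum>k<Suc n. t ^ k / fact k * F k 0)\<bar> \<le> t * (exp t * C) * (t ^ n / fact n)" for n
  proof -
    have "continuous_on {0..t} (h (Suc n))"
      unfolding h_def by (intro continuous_intros cont) auto
    moreover have "h (Suc n) differentiable (at s)" if "0 < s" "s < t" for s
      using h_deriv[OF that] real_differentiable_def by blast
    ultimately obtain l z where z: "0 < z" "z < t"
      and l: "(h (Suc n) has_real_derivative l) (at z)" and eq: "h (Suc n) t - h (Suc n) 0 = (t - 0) * l"
      using MVT[OF t] by metis
    have l_eq: "l = exp z * (t - z) ^ n / fact n * F (Suc n) z"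
      by (rule DERIV_unique[OF l h_deriv[OF z]])
    have "\<bar>l\<bar> = exp z * ((t - z) ^ n / fact n) * \<bar>F (Suc n) z\<bar>"
      using z by (simp add: l_eq abs_mult)
    also have "\<dots> \<le> exp t * (t ^ n / fact n) * C"
      using z bound[of z "Suc n"]
      by (intro mult_mono divide_right_mono power_mono) auto
    finally have "t * \<bar>l\<bar> \<le> t * (exp t * (t ^ n / fact n) * C)"
      using t by (intro mult_left_mono) auto
    \<comment> \<open>At s = t only the summand k = 0 survives, with 0^0 = 1.\<close>
    moreover have "h (Suc n) t = exp t * F 0 t"
      unfolding h_def by (subst sum.lessThan_Suc_shift) simp
    moreover have "h (Suc n) 0 = (\<Sum>k<Suc n. t ^ k / fact k * F k 0)"
      unfolding h_def by simp
    ultimately show ?thesis using eq t by (simp add: abs_mult algebra_simps)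
  qed
  have "(\<lambda>n. t ^ n / fact n) \<longlonglongrightarrow> 0"
    using summable_LIMSEQ_zero[OF summable_exp_generic[of t]] by (simp add: field_simps)
  then have "(\<lambda>n. t * (exp t * C) * (t ^ n / fact n)) \<longlonglongrightarrow> 0"
    by (rule tendsto_mult_right_zero)
  then have "(\<lambda>n. exp t * F 0 t - (\<Sum>k<Suc n. t ^ k / fact k * F k 0)) \<longlonglongrightarrow> 0"
    by (rule Lim_null_comparison[rotated]) (unfold real_norm_def, intro always_eventually allI bd)
  then have "(\<lambda>n. exp t * F 0 t - (exp t * F 0 t - (\<Sum>k<Suc n. t ^ k / fact k * F k 0)))
      \<longlonglongrightarrow> exp t * F 0 t - 0"
    by (intro tendsto_diff tendsto_const)
  then have "(\<lambda>n. \<Sum>k<Suc n. t ^ k / fact k * F k 0) \<longlonglongrightarrow> exp t * F 0 t"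
    by (simp only: diff_diff_eq2 add_diff_cancel_left' diff_0_right)
  then have "(\<lambda>k. t ^ k / fact k * F k 0) sums (exp t * F 0 t)"
    unfolding sums_def by (simp only: filterlim_sequentially_Suc[of "\<lambda>n. \<Sum>k<n. t ^ k / fact k * F k 0"])
  from sums_mult[OF this, of "exp (- t)"] show ?thesis
    by (simp add: mult.assoc[symmetric] exp_minus_inverse mult.commute[of "exp (- t)"])
qed

text \<open>These are the generating function and the mean of the Poisson law. The value 1 of
  \<open>\<rho>\<close> gives the normalisation of the weights.\<close>

lemma poisson_sums:
  fixes t \<rho> :: real
  shows "(\<lambda>k. exp (- t) * t ^ k / fact k * \<rho> ^ k) sums exp (- t * (1 - \<rho>))"
    and "(\<lambda>k. exp (- t) * t ^ k / fact k * real k) sums t"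
proof -
  have "(\<lambda>k. exp (- t) * ((t * \<rho>) ^ k /\<^sub>R fact k)) sums (exp (- t) * exp (t * \<rho>))"
    by (intro sums_mult exp_converges)
  moreover have "exp (- t) * exp (t * \<rho>) = exp (- t * (1 - \<rho>))"
    by (simp add: exp_add[symmetric] algebra_simps)
  ultimately show "(\<lambda>k. exp (- t) * t ^ k / fact k * \<rho> ^ k) sums exp (- t * (1 - \<rho>))"
    by (simp add: power_mult_distrib field_simps)
  have "(\<lambda>k. exp (- t) * t * (t ^ k /\<^sub>R fact k)) sums (exp (- t) * t * exp t)"
    by (intro sums_mult exp_converges)
  then have "(\<lambda>k. exp (- t) * t ^ Suc k / fact (Suc k) * real (Suc k)) sums t"
    by (simp add: field_simps exp_minus_inverse exp_minus del: of_nat_Suc)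
  then show "(\<lambda>k. exp (- t) * t ^ k / fact k * real k) sums t"
    using sums_Suc[of "\<lambda>k. exp (- t) * t ^ k / fact k * real k" t] by simp
qed

section \<open>Self-adjointness of convolution with \<open>J\<close>\<close>

context jump_kernel
begin

text \<open>Fubini and the symmetry J(x - y) = J(y - x). As the product measure is formed over
  \<open>lborel\<close>, \<open>u\<close> is first replaced by a Borel representative
  \<open>v\<close>.\<close>

lemma conv_duality:
  assumes u: "integrable lebesgue u" and g[measurable]: "g \<in> borel_measurable borel"
    and g_bound: "\<And>x. \<bar>g x\<bar> \<le> 1"
  shows "integrable lebesgue (\<lambda>x. g x * conv J u x)"
    and "(LINT x|lebesgue. g x * conv J u x) = (LINT x|lebesgue. u x * conv J g x)"
proof -
  have u_meas: "u \<in> borel_measurable lebesgue" using u by (rule borel_measurable_integrable)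
  obtain v where v[measurable]: "v \<in> borel_measurable borel" and eq: "AE x in lborel. u x = v x"
    using completion_ex_borel_measurable_real[OF u_meas] by auto
  have eq': "AE x in lebesgue. u x = v x" using eq by (rule AE_completion)
  have v': "v \<in> borel_measurable lebesgue" by (rule borel_imp_lebesgue_measurable[OF v])
  have "integrable lebesgue v"
    using integrable_cong_AE[OF u_meas v' eq'] u by simp
  then have v_int: "integrable lborel v" using integrable_completion[of v lborel] by simp
  have conv_u: "conv J u x = (LINT y|lborel. J (x - y) * v y)" for x
  proof -
    have "(\<lambda>y. J (x - y)) \<in> borel_measurable lebesgue"
      by (intro borel_imp_lebesgue_measurable) measurable
    then have "conv J u x = (LINT y|lebesgue. J (x - y) * v y)"
      unfolding conv_def using u_meas v' eq'
      by (intro integral_cong_AE borel_measurable_times) (auto elim!: eventually_mono)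
    also have "\<dots> = (LINT y|lborel. J (x - y) * v y)"
      by (rule integral_completion) measurable
    finally show ?thesis .
  qed
  \<comment> \<open>For fixed \<open>y\<close> the integrand is dominated by |v(y)| J(x - y), whose
    integral in \<open>x\<close> is |v(y)|. This gives integrability on the product.\<close>
  define f where "f y x = g x * (J (x - y) * v y)" for y x
  have f[measurable]: "(\<lambda>(y, x). f y x) \<in> borel_measurable (lborel \<Otimes>\<^sub>M lborel)"
    unfolding f_def by measurable
  have J_int: "integrable lborel (\<lambda>x. J (x - y))" for y
  proof -
    have "integrable lebesgue (\<lambda>x. J (y - x) * 1)"
      by (intro integrable_conv locally_bounded_measurable_continuous) auto
    then show ?thesis using J_diff_commute[of _ y] integrable_completion[of "\<lambda>x. J (y - x)" lborel] by simp
  qed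
  have J_int_1: "(LINT x|lborel. J (x - y)) = 1" for y
    using integral_lborel_reflect[of J y] J_diff_commute[of y] J_mass by simp
  have f_le: "\<bar>f y x\<bar> \<le> \<bar>v y\<bar> * J (x - y)" for x y
    using g_bound[of x] mult_right_mono[of "\<bar>g x\<bar>" 1 "\<bar>v y\<bar> * J (x - y)"] J_nonneg[of "x - y"]
    by (simp add: f_def abs_mult ac_simps)
  have f_int: "integrable lborel (f y)" for y
  proof (rule Bochner_Integration.integrable_bound)
    show "integrable lborel (\<lambda>x. \<bar>v y\<bar> * J (x - y))" using J_int by simp
    show "f y \<in> borel_measurable lborel" unfolding f_def by measurable
  qed (use f_le J_nonneg in \<open>auto simp: abs_mult\<close>)
  have "integrable (lborel \<Otimes>\<^sub>M lborel) (\<lambda>(y, x). f y x)"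
  proof (rule lborel_pair.Fubini_integrable)
    show "integrable lborel (\<lambda>y. LINT x|lborel. norm (case (y, x) of (y, x) \<Rightarrow> f y x))"
    proof (rule Bochner_Integration.integrable_bound[OF v_int])
      have "(LINT x|lborel. \<bar>f y x\<bar>) \<le> \<bar>v y\<bar>" for y
      proof -
        have "(LINT x|lborel. \<bar>f y x\<bar>) \<le> (LINT x|lborel. \<bar>v y\<bar> * J (x - y))"
          using f_int f_le J_int by (intro integral_mono) auto
        then show ?thesis by (simp add: J_int_1)
      qed
      then show "AE y in lborel. norm (LINT x|lborel. norm (case (y, x) of (y, x) \<Rightarrow> f y x)) \<le> norm (v y)"
        by (auto simp: abs_of_nonneg)
    qed (simp, measurable)
  qed (use f_int in auto)
  note Fub = lborel_pair.integral_fst[OF this] lborel_pair.integral_snd[OF this] lborel_pair.integrable_snd[OF this]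
  have inner1: "(LINT y|lborel. f y x) = g x * conv J u x" for x
    unfolding f_def conv_u by simp
  have inner2: "(LINT x|lborel. f y x) = v y * conv J g y" for y
  proof -
    have "conv J g y = (LINT x|lborel. J (y - x) * g x)"
      unfolding conv_def by (rule integral_completion) measurable
    moreover have "(LINT x|lborel. f y x) = (LINT x|lborel. v y * (J (y - x) * g x))"
      unfolding f_def by (intro Bochner_Integration.integral_cong) (auto simp: J_diff_commute[of y])
    ultimately show ?thesis by simp
  qed
  have [measurable]: "conv J u \<in> borel_measurable borel" "conv J g \<in> borel_measurable borel"
    using borel_conv u_meas borel_imp_lebesgue_measurable[OF g] by auto
  show "integrable lebesgue (\<lambda>x. g x * conv J u x)"
    using Fub(3) integrable_completion[of "\<lambda>x. g x * conv J u x" lborel] by (simp add: inner1)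
  have "(LINT x|lebesgue. g x * conv J u x) = (LINT x|lborel. g x * conv J u x)"
    by (rule integral_completion) measurable
  also have "\<dots> = (LINT y|lborel. v y * conv J g y)"
    using Fub(1,2) by (simp add: inner1 inner2)
  also have "\<dots> = (LINT y|lebesgue. v y * conv J g y)"
    by (rule integral_completion[symmetric]) measurable
  also have "\<dots> = (LINT y|lebesgue. u y * conv J g y)"
    using u_meas v' eq' borel_imp_lebesgue_measurable[of "conv J g"]
    by (intro integral_cong_AE borel_measurable_times) (auto elim!: eventually_mono)
  finally show "(LINT x|lebesgue. g x * conv J u x) = (LINT x|lebesgue. u x * conv J g x)" .
qed

end

section \<open>Bounds from the stationary solution\<close>

context killed_jump
begin

text \<open>The bound rests on $\ln y \le y - 1$ with $y = |x|^2 / \mu$, a form of Jensen's inequality.\<close>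
lemma stationary_pairing_le:
  assumes \<phi>: "locally_bounded_measurable \<phi>" "killed_conv \<phi> = \<phi>"
    and log: "AE x in lebesgue. x \<notin> H \<longrightarrow> \<phi> x \<le> ln (norm x) + C"
    and H: "0 \<in> H" and \<mu>: "0 < \<mu>"
    and f: "AE x in lebesgue. 0 \<le> f x" "integrable lebesgue f"
      "integrable lebesgue (\<lambda>x. f x * (norm x)\<^sup>2)" "integrable lebesgue (\<lambda>x. f x * \<phi> x)"
    and survival_int: "integrable lebesgue (\<lambda>x. f x * survival k x)"
  shows "(LINT x|lebesgue. f x * \<phi> x) \<le> (C + ln \<mu> / 2) * (LINT x|lebesgue. f x * survival k x)
    + ((LINT x|lebesgue. f x * (norm x)\<^sup>2)
        + (LINT y|lborel. J y * (norm y)\<^sup>2) * real k * (LINT x|lebesgue. f x)) / (2 * \<mu>)"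
proof -
  define V where "V = (LINT y|lborel. J y * (norm y)\<^sup>2)"
  define one where "one = (\<lambda>x. if x \<in> H then 0 else 1 :: real)"
  define w where "w = (\<lambda>x. if x \<in> H then 0 else (norm x)\<^sup>2)"
  define c where "c = C + ln \<mu> / 2"
  have lbm: "locally_bounded_measurable one" "locally_bounded_measurable w"
    unfolding one_def w_def by (intro locally_bounded_measurable_alive continuous_intros)+
  have \<phi>_H: "\<phi> x = 0" if "x \<in> H" for x
    using that fun_cong[OF \<phi>(2), of x] by (simp add: killed_conv_def)
  have ln_le: "ln (norm x) \<le> ln \<mu> / 2 + (norm x)\<^sup>2 / (2 * \<mu>)" if "x \<notin> H" for x
  proof -
    have "0 < norm x" using that H by auto
    then have "ln ((norm x)\<^sup>2 / \<mu>) \<le> (norm x)\<^sup>2 / \<mu> - 1" and "ln ((norm x)\<^sup>2) = 2 * ln (norm x)"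
      using \<mu> by (auto intro!: ln_le_minus_one simp: ln_realpow)
    then show ?thesis using \<mu> \<open>0 < norm x\<close> by (simp add: ln_div)
  qed
  \<comment> \<open>Both sides vanish on \<open>H\<close>. Under T^k the left side stays fixed,
    \<open>one\<close> becomes \<open>survival k\<close>, and \<open>w\<close> grows at most
    linearly in \<open>k\<close>.\<close>
  have "AE x in lebesgue. \<phi> x \<le> c * one x + (1 / (2 * \<mu>)) * w x"
    using log by eventually_elim (use ln_le \<phi>_H in \<open>force simp: one_def w_def c_def\<close>)
  from killed_conv_mono[OF \<phi>(1) locally_bounded_measurable_linear[OF lbm] this, of k]
  have "AE x in lebesgue. (killed_conv ^^ k) \<phi> x \<le> c * survival k x + 1 / (2 * \<mu>) * (killed_conv ^^ k) w x"
    unfolding killed_conv_linear[OF lbm] by (simp add: survival_def one_def)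
  moreover have "(killed_conv ^^ k) \<phi> = \<phi>" by (induction k) (simp_all add: \<phi>(2))
  moreover have "1 / (2 * \<mu>) * (killed_conv ^^ k) w x \<le> 1 / (2 * \<mu>) * ((norm x)\<^sup>2 + V * real k)" for x
    unfolding w_def V_def using \<mu> by (intro mult_left_mono killed_conv_norm_squared_le) auto
  ultimately have "AE x in lebesgue. \<phi> x \<le> c * survival k x + 1 / (2 * \<mu>) * ((norm x)\<^sup>2 + V * real k)"
    by (auto elim!: eventually_mono intro: order_trans)
  with f(1) have le: "AE x in lebesgue. f x * \<phi> x \<le>
      c * (f x * survival k x) + 1 / (2 * \<mu>) * (f x * (norm x)\<^sup>2 + V * real k * f x)"
  proof eventually_elim
    case (elim x)
    from mult_left_mono[OF elim(2,1)] show ?case by (simp add: algebra_simps)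
  qed
  have "(LINT x|lebesgue. f x * \<phi> x) \<le>
      (LINT x|lebesgue. c * (f x * survival k x) + 1 / (2 * \<mu>) * (f x * (norm x)\<^sup>2 + V * real k * f x))"
    using le f survival_int by (intro integral_mono_AE) auto
  also have "\<dots> = c * (LINT x|lebesgue. f x * survival k x)
      + 1 / (2 * \<mu>) * ((LINT x|lebesgue. f x * (norm x)\<^sup>2) + V * real k * (LINT x|lebesgue. f x))"
    using f survival_int by simp
  finally show ?thesis by (simp add: c_def V_def)
qed

text \<open>The logarithm is at least \<open>ln r\<close> outside the ball of radius
  \<open>r\<close>, and inside it the subtracted cosine mean brings the minorant down to at most
  zero. Its image under T^k is small uniformly in \<open>x\<close>, so the error costs only a
  multiple of the integral of \<open>f\<close>.\<close>

lemma stationary_pairing_ge: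
  assumes \<phi>: "locally_bounded_measurable \<phi>" "killed_conv \<phi> = \<phi>"
    and log: "AE x in lebesgue. x \<notin> H \<longrightarrow> ln (norm x) - C \<le> \<phi> x"
    and H: "ball 0 1 \<subseteq> H" and r: "1 \<le> r"
    and e: "norm e = 1" and N: "0 < N" and s: "0 < s" "real N * s * d \<le> 1" "real N * s * r \<le> 1"
    and f: "AE x in lebesgue. 0 \<le> f x" "integrable lebesgue f" "integrable lebesgue (\<lambda>x. f x * \<phi> x)"
    and survival_int: "integrable lebesgue (\<lambda>x. f x * survival k x)"
  shows "(ln r - C) * (LINT x|lebesgue. f x * survival k x)
      - 2 * ln r * (1 / real N + (1 - s\<^sup>2 / 4 * (LINT y|lborel. J y * (y \<bullet> e)\<^sup>2)) ^ k) * (LINT x|lebesgue. f x)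
    \<le> (LINT x|lebesgue. f x * \<phi> x)"
proof -
  define b where "b = 1 / real N + (1 - s\<^sup>2 / 4 * (LINT y|lborel. J y * (y \<bullet> e)\<^sup>2)) ^ k"
  define one where "one = (\<lambda>x. if x \<in> H then 0 else 1 :: real)"
  \<comment> \<open>The cosine mean is not cut off on \<open>H\<close>: it is a finite sum of
    eigenfunctions of the free convolution, and its sign keeps the minorant below
    \<open>\<phi> = 0\<close> there.\<close>
  define g where "g x = cosine_mean N (s * (x \<bullet> e))" for x
  have ln_r: "0 \<le> ln r" using r by simp
  have lbm: "locally_bounded_measurable one" "locally_bounded_measurable g"
    unfolding one_def g_def cosine_mean_def
    by (intro locally_bounded_measurable_alive locally_bounded_measurable_continuous continuous_intros)+
  have g_nonneg: "0 \<le> g x" for x by (simp add: g_def cosine_mean_nonneg)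
  have \<phi>_H: "\<phi> x = 0" if "x \<in> H" for x
    using that fun_cong[OF \<phi>(2), of x] by (simp add: killed_conv_def)
  have ln_ge: "ln r - 2 * ln r * g x \<le> ln (norm x)" if "x \<notin> H" for x
  proof -
    \<comment> \<open>This is where the unit ball in \<open>H\<close> matters: off \<open>H\<close>
      the logarithm is nonnegative.\<close>
    have x: "1 \<le> norm x" using that H by (metis dist_0_norm linorder_not_le mem_ball subsetD)
    show ?thesis
    proof (cases "norm x \<le> r")
      case True
      have "\<bar>x \<bullet> e\<bar> \<le> r" using Cauchy_Schwarz_ineq2[of x e] e True by simp
      then have "real N * s * \<bar>x \<bullet> e\<bar> \<le> real N * s * r" using s by (intro mult_left_mono) auto
      then have "real N * \<bar>s * (x \<bullet> e)\<bar> \<le> 1" using s by (simp add: abs_mult mult.assoc)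
      from cosine_mean_ge_half[OF N this] have "1 / 2 \<le> g x" by (simp add: g_def)
      then have "2 * ln r * (1 / 2) \<le> 2 * ln r * g x" using ln_r by (intro mult_left_mono) auto
      moreover have "0 \<le> ln (norm x)" using x by simp
      ultimately show ?thesis by simp
    next
      case False
      then have "ln r \<le> ln (norm x)" using r by (subst ln_le_cancel_iff) linarith+
      moreover have "0 \<le> 2 * ln r * g x" using ln_r g_nonneg by simp
      ultimately show ?thesis by linarith
    qed
  qed
  have "AE x in lebesgue. (ln r - C) * one x + (- (2 * ln r)) * g x \<le> \<phi> x"
    using log
  proof eventually_elim
    case (elim x)
    show ?case
    proof (cases "x \<in> H")
      case True
      then show ?thesis using ln_r g_nonneg[of x] by (simp add: one_def \<phi>_H)
    next
      case False
      then show ?thesis using elim ln_ge[of x] by (simp add: one_def)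
    qed
  qed
  from killed_conv_mono[OF locally_bounded_measurable_linear[OF lbm] \<phi>(1) this, of k]
  have AE_ge: "AE x in lebesgue. (ln r - C) * survival k x + - (2 * ln r) * (killed_conv ^^ k) g x \<le> (killed_conv ^^ k) \<phi> x"
    unfolding killed_conv_linear[OF lbm] by (simp add: survival_def one_def)
  have \<phi>_fixed: "(killed_conv ^^ k) \<phi> = \<phi>" by (induction k) (simp_all add: \<phi>(2))
  have g_le: "2 * ln r * (killed_conv ^^ k) g x \<le> 2 * ln r * b" for x
  proof (intro mult_left_mono)
    have "(killed_conv ^^ k) g x \<le> (conv J ^^ k) g x"
      by (rule killed_conv_le_conv(1)[OF lbm(2) g_nonneg])
    also have "\<dots> \<le> b"
      using conv_power_cosine_mean_le[OF e N s(1,2), of k x] by (simp add: b_def g_def[abs_def])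
    finally show "(killed_conv ^^ k) g x \<le> b" .
  qed (use ln_r in simp)
  have "AE x in lebesgue. (ln r - C) * survival k x - 2 * ln r * b \<le> \<phi> x"
    using AE_ge
  proof eventually_elim
    case (elim x)
    with g_le[of x] show ?case unfolding \<phi>_fixed by linarith
  qed
  with f(1) have le: "AE x in lebesgue. (ln r - C) * (f x * survival k x) - 2 * ln r * b * f x \<le> f x * \<phi> x"
  proof eventually_elim
    case (elim x)
    from mult_left_mono[OF elim(2,1)] show ?case by (simp add: algebra_simps)
  qed
  have "(LINT x|lebesgue. (ln r - C) * (f x * survival k x) - 2 * ln r * b * f x)
      \<le> (LINT x|lebesgue. f x * \<phi> x)"
    using le f survival_int by (intro integral_mono_AE) auto
  moreover have "(LINT x|lebesgue. (ln r - C) * (f x * survival k x) - 2 * ln r * b * f x)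
      = (ln r - C) * (LINT x|lebesgue. f x * survival k x) - 2 * ln r * b * (LINT x|lebesgue. f x)"
    using f survival_int by simp
  ultimately show ?thesis by (simp add: b_def)
qed

end

section \<open>The mass as a Poisson average\<close>

lemma integral_bounded_mult_le:
  fixes f q :: "'a \<Rightarrow> real"
  assumes "integrable M f" "\<And>x. \<bar>q x\<bar> \<le> 1"
  shows "\<bar>LINT x|M. f x * q x\<bar> \<le> (LINT x|M. \<bar>f x\<bar>)"
proof -
  have "\<bar>LINT x|M. f x * q x\<bar> \<le> (LINT x|M. \<bar>f x * q x\<bar>)" by (rule integral_abs_bound)
  also have "\<dots> \<le> (LINT x|M. \<bar>f x\<bar>)"
    using assms mult_left_le[of "\<bar>q _\<bar>" "\<bar>f _\<bar>"] by (intro integral_mono') (auto simp: abs_mult)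
  finally show ?thesis .
qed

context killed_jump
begin

lemma abs_survival_le: "\<bar>survival k x\<bar> \<le> 1"
  using survival_nonneg[of k x] survival_le_1[of k x] by simp

lemma integrable_mult_survival:
  assumes "integrable lebesgue f"
  shows "integrable lebesgue (\<lambda>x. f x * survival k x)"
proof (rule Bochner_Integration.integrable_bound[OF assms])
  show "(\<lambda>x. f x * survival k x) \<in> borel_measurable lebesgue"
    using assms borel_imp_lebesgue_measurable[OF borel_survival[of k]]
    by (intro borel_measurable_times) auto
  show "AE x in lebesgue. norm (f x * survival k x) \<le> norm (f x)"
    using abs_survival_le[of k] by (auto simp: abs_mult intro!: mult_left_le)
qed

text \<open>Duality moves \<open>J *\<close> onto the survival probability. Since \<open>f\<close>
  vanishes on \<open>H\<close>, the convolution may be cut off there, and that produces the next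
  survival probability.\<close>

lemma pairing_survival_Suc:
  assumes f: "integrable lebesgue f" and f_H: "AE x in lebesgue. x \<in> H \<longrightarrow> f x = 0"
  shows "integrable lebesgue (\<lambda>x. nonlocal_op J f x * survival k x)"
    and "(LINT x|lebesgue. nonlocal_op J f x * survival k x)
      = (LINT x|lebesgue. f x * survival (Suc k) x) - (LINT x|lebesgue. f x * survival k x)"
proof -
  note duality = conv_duality[OF f borel_survival[of k] abs_survival_le]
  have eq: "nonlocal_op J f x * survival k x = survival k x * conv J f x - f x * survival k x" for x
    by (simp add: nonlocal_op_def algebra_simps)
  show "integrable lebesgue (\<lambda>x. nonlocal_op J f x * survival k x)"
    unfolding eq by (intro Bochner_Integration.integrable_diff duality(1) integrable_mult_survival f)
  have "(LINT x|lebesgue. nonlocal_op J f x * survival k x)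
      = (LINT x|lebesgue. f x * conv J (survival k) x) - (LINT x|lebesgue. f x * survival k x)"
    unfolding eq using duality integrable_mult_survival[OF f] by simp
  also have "(LINT x|lebesgue. f x * conv J (survival k) x) = (LINT x|lebesgue. f x * survival (Suc k) x)"
  proof (rule integral_cong_AE)
    have meas: "f \<in> borel_measurable lebesgue" using f by simp
    show "(\<lambda>x. f x * conv J (survival k) x) \<in> borel_measurable lebesgue"
      using meas borel_imp_lebesgue_measurable[OF borel_conv[OF borel_imp_lebesgue_measurable[OF borel_survival[of k]]]]
      by (rule borel_measurable_times)
    show "(\<lambda>x. f x * survival (Suc k) x) \<in> borel_measurable lebesgue"
      using meas borel_imp_lebesgue_measurable[OF borel_survival[of "Suc k"]]
      by (rule borel_measurable_times)
    show "AE x in lebesgue. f x * conv J (survival k) x = f x * survival (Suc k) x"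
      using f_H by eventually_elim (auto simp: survival_Suc)
  qed
  finally show "(LINT x|lebesgue. nonlocal_op J f x * survival k x)
      = (LINT x|lebesgue. f x * survival (Suc k) x) - (LINT x|lebesgue. f x * survival k x)" .
qed

lemma exterior_solution_mass_sums:
  assumes sol: "exterior_solution J H u\<^sub>0 u" and u0_meas: "u\<^sub>0 \<in> borel_measurable lebesgue"
    and t: "0 < t"
  shows "(\<lambda>k. exp (- t) * t ^ k / fact k * (LINT x|lebesgue. u\<^sub>0 x * survival k x)) sums (LINT x|lebesgue. u t x)"
proof -
  define F where "F k s = (LINT x|lebesgue. u s x * survival k x)" for k s
  \<comment> \<open>The L^1 norm is continuous in time, so its maximum on [0, t] bounds all pairings
    \<open>F k\<close> at once, independently of \<open>k\<close>.\<close>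
  define n where "n s = (LINT x|lebesgue. \<bar>u s x\<bar>)" for s
  have int: "integrable lebesgue (u s)" if "0 \<le> s" for s
    using sol that by (auto simp: exterior_solution_def C_L1_def)
  have cont: "((\<lambda>s. LINT x|lebesgue. \<bar>u s x - u t x\<bar>) \<longlongrightarrow> 0) (at t within {0..})" if "0 \<le> t" for t
    using sol that by (auto simp: exterior_solution_def C_L1_def)
  have der: "((\<lambda>s. LINT x|lebesgue_on (- H). \<bar>(u s x - u t x) / (s - t) - nonlocal_op J (u t) x\<bar>) \<longlongrightarrow> 0) (at t)"
    if "0 < t" for t
    using sol that by (auto simp: exterior_solution_def)
  have u_H: "AE x in lebesgue. x \<in> H \<longrightarrow> u s x = 0" if "0 < s" for s
    using sol that by (auto simp: exterior_solution_def)
  have continuousI: "continuous_on {0..} G"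
    if G: "\<And>s t. 0 \<le> s \<Longrightarrow> 0 \<le> t \<Longrightarrow> \<bar>G s - G t\<bar> \<le> (LINT x|lebesgue. \<bar>u s x - u t x\<bar>)" for G :: "real \<Rightarrow> real"
    unfolding continuous_on_def
  proof
    fix t :: real assume t: "t \<in> {0..}"
    have "((\<lambda>s. G s - G t) \<longlongrightarrow> 0) (at t within {0..})"
    proof (rule Lim_null_comparison[OF _ cont])
      show "\<forall>\<^sub>F s in at t within {0..}. norm (G s - G t) \<le> (LINT x|lebesgue. \<bar>u s x - u t x\<bar>)"
        using G t by (auto simp: eventually_at_filter intro!: always_eventually)
    qed (use t in simp)
    then show "(G \<longlongrightarrow> G t) (at t within {0..})" by (simp only: LIM_zero_iff)
  qed
  have F_cont: "continuous_on {0..} (F k)" for k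
  proof (rule continuousI)
    fix s t :: real assume "0 \<le> s" "0 \<le> t"
    then have "F k s - F k t = (LINT x|lebesgue. (u s x - u t x) * survival k x)"
      unfolding F_def using integrable_mult_survival[OF int] by (simp add: left_diff_distrib)
    then show "\<bar>F k s - F k t\<bar> \<le> (LINT x|lebesgue. \<bar>u s x - u t x\<bar>)"
      using \<open>0 \<le> s\<close> \<open>0 \<le> t\<close> by (simp add: integral_bounded_mult_le int abs_survival_le)
  qed
  have "continuous_on {0..} n"
  proof (rule continuousI)
    fix s t :: real assume *: "0 \<le> s" "0 \<le> t"
    then have "\<bar>n s - n t\<bar> = \<bar>LINT x|lebesgue. \<bar>u s x\<bar> - \<bar>u t x\<bar>\<bar>"
      unfolding n_def using int by simp
    also have "\<dots> \<le> (LINT x|lebesgue. \<bar>\<bar>u s x\<bar> - \<bar>u t x\<bar>\<bar>)" by (rule integral_abs_bound)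
    also have "\<dots> \<le> (LINT x|lebesgue. \<bar>u s x - u t x\<bar>)"
      using int * by (intro integral_mono) auto
    finally show "\<bar>n s - n t\<bar> \<le> (LINT x|lebesgue. \<bar>u s x - u t x\<bar>)" .
  qed
  then have "compact (n ` {0..t})"
    by (intro compact_continuous_image) (auto elim: continuous_on_subset)
  then obtain C where C: "\<forall>y\<in>n ` {0..t}. norm y \<le> C"
    using compact_imp_bounded bounded_iff by metis
  have F_bound: "\<bar>F k s\<bar> \<le> C" if "0 \<le> s" "s \<le> t" for k s
  proof -
    have "\<bar>F k s\<bar> \<le> n s"
      unfolding F_def n_def using that by (intro integral_bounded_mult_le int abs_survival_le)
    moreover have "\<bar>n s\<bar> \<le> C" using C that by simp
    ultimately show ?thesis by simp
  qed
  have F_deriv: "(F k has_real_derivative F (Suc k) s - F k s) (at s)" if s: "0 < s" for k s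
    unfolding has_field_derivative_iff
  proof -
    let ?D = "\<lambda>r x. (u r x - u s x) / (r - s) - nonlocal_op J (u s) x"
    have op: "integrable lebesgue (\<lambda>x. nonlocal_op J (u s) x * survival j x)"
      and op_eq: "(LINT x|lebesgue. nonlocal_op J (u s) x * survival j x) = F (Suc j) s - F j s" for j
      using pairing_survival_Suc[OF int u_H] s by (auto simp: F_def)
    have bound: "\<bar>(F k r - F k s) / (r - s) - (F (Suc k) s - F k s)\<bar> \<le> (LINT x|lebesgue_on (- H). \<bar>?D r x\<bar>)"
      if r: "0 < r" "r \<noteq> s" for r
    proof -
      have q: "integrable lebesgue (\<lambda>x. (u r x - u s x) / (r - s))"
        using int[of r] int[of s] s r by simp
      have "(F k r - F k s) / (r - s) = (LINT x|lebesgue. (u r x - u s x) / (r - s) * survival k x)"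
        unfolding F_def using integrable_mult_survival[OF int] s r
        by (simp add: left_diff_distrib diff_divide_distrib)
      then have "(F k r - F k s) / (r - s) - (F (Suc k) s - F k s) = (LINT x|lebesgue. ?D r x * survival k x)"
        using op integrable_mult_survival[OF q] by (simp add: op_eq left_diff_distrib)
      \<comment> \<open>The equation controls the difference quotients only off \<open>H\<close>;
        \<open>survival k\<close> vanishes on \<open>H\<close>, so nothing is lost by
        restricting.\<close>
      also have "\<dots> = (LINT x|lebesgue. indicator (- H) x *\<^sub>R (?D r x * survival k x))"
        by (intro Bochner_Integration.integral_cong) (auto simp: indicator_def survival_hole)
      also have "\<dots> = (LINT x|lebesgue_on (- H). ?D r x * survival k x)"
        by (rule integral_restrict_space[symmetric]) (simp add: lebesgue_H)
      finally have eq: "(F k r - F k s) / (r - s) - (F (Suc k) s - F k s) = (LINT x|lebesgue_on (- H). ?D r x * survival k x)" .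
      have "integrable lebesgue (nonlocal_op J (u s))"
        using conv_duality(1)[OF int, of s "\<lambda>_. 1"] int[of s] s
        by (simp add: nonlocal_op_def[abs_def])
      then have "integrable lebesgue (?D r)" using q by simp
      then have "integrable (lebesgue_on (- H)) (?D r)"
        using lebesgue_H integrable_mult_indicator[of "- H" lebesgue "?D r"]
        by (subst integrable_restrict_space) (auto simp: Compl_in_sets_lebesgue)
      then show ?thesis unfolding eq by (intro integral_bounded_mult_le abs_survival_le)
    qed
    have "((\<lambda>r. (F k r - F k s) / (r - s) - (F (Suc k) s - F k s)) \<longlongrightarrow> 0) (at s)"
    proof (rule Lim_null_comparison[OF _ der[OF s]])
      show "\<forall>\<^sub>F r in at s. norm ((F k r - F k s) / (r - s) - (F (Suc k) s - F k s)) \<le> (LINT x|lebesgue_on (- H). \<bar>?D r x\<bar>)"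
        unfolding eventually_at
      \<comment> \<open>The radius \<open>s\<close> keeps \<open>r\<close> positive, where the
        pairing identities are available.\<close>
      proof (intro exI[of _ s] conjI ballI impI)
        fix r assume "r \<noteq> s \<and> dist r s < s"
        then have "0 < r" "r \<noteq> s" by (auto simp: dist_real_def)
        then show "norm ((F k r - F k s) / (r - s) - (F (Suc k) s - F k s)) \<le> (LINT x|lebesgue_on (- H). \<bar>?D r x\<bar>)"
          using bound by simp
      qed (use s in simp)
    qed
    then show "((\<lambda>r. (F k r - F k s) / (r - s)) \<longlongrightarrow> F (Suc k) s - F k s) (at s)"
      by (simp only: LIM_zero_iff)
  qed
  have "(\<lambda>k. exp (- t) * t ^ k / fact k * F k 0) sums F 0 t"
  proof (rule poisson_hierarchy_sums[OF t])
    show "continuous_on {0..t} (F k)" for k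
      by (rule continuous_on_subset[OF F_cont]) auto
  qed (use F_deriv F_bound in auto)
  moreover have "F k 0 = (LINT x|lebesgue. u\<^sub>0 x * survival k x)" for k
  proof -
    have ae: "AE x in lebesgue. u 0 x = u\<^sub>0 x" using sol by (simp add: exterior_solution_def)
    have "u 0 \<in> borel_measurable lebesgue" using int[of 0] by simp
    then show ?thesis
      unfolding F_def using u0_meas ae borel_imp_lebesgue_measurable[OF borel_survival[of k]]
      by (intro integral_cong_AE borel_measurable_times) (auto elim!: eventually_mono)
  qed
  \<comment> \<open>For positive times \<open>u t\<close> vanishes on \<open>H\<close>, so pairing
    with the indicator of the complement gives the whole mass.\<close>
  moreover have "F 0 t = (LINT x|lebesgue. u t x)"
    unfolding F_def
  proof (rule integral_cong_AE)
    show "(\<lambda>x. u t x * survival 0 x) \<in> borel_measurable lebesgue"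
      using integrable_mult_survival[OF int, of t 0] t by simp
    show "AE x in lebesgue. u t x * survival 0 x = u t x"
      using u_H[OF t] by eventually_elim (auto simp: survival_def)
  qed (use int[of t] t in simp)
  ultimately show ?thesis by simp
qed

end

section \<open>The limit\<close>

text \<open>The upper bound on \<open>m\<close> gives the lower bound \<open>lo\<close> on the mass,
  and the lower bound on \<open>m\<close> gives \<open>up\<close>. In both, the coefficient of
  \<open>M t\<close> is asymptotic to (ln t)/2, which is the source of the factor 2.\<close>

lemma logarithmic_decay_limit:
  fixes M :: "real \<Rightarrow> real" and A B C K d m v :: real
  assumes upper: "\<And>t \<mu>. 0 < t \<Longrightarrow> 0 < \<mu> \<Longrightarrow> m \<le> (C + ln \<mu> / 2) * M t + (A + B * t) / (2 * \<mu>)"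
    and lower: "\<And>t r N s. 0 < t \<Longrightarrow> 1 \<le> r \<Longrightarrow> 0 < N \<Longrightarrow> 0 < s \<Longrightarrow> real N * s * d \<le> 1 \<Longrightarrow> real N * s * r \<le> 1
      \<Longrightarrow> (ln r - C) * M t - 2 * ln r * (1 / real N + exp (- t * (s\<^sup>2 / 4 * v))) * K \<le> m"
    and v: "0 < v" and K: "0 \<le> K" and d: "0 < d"
  shows "((\<lambda>t. ln t * M t) \<longlongrightarrow> 2 * m) at_top"
proof (rule tendsto_sandwich)
  \<comment> \<open>Here s^2 t = (ln t)^2, so the exponential decays faster than any power of t, and
    (ln r)/N tends to 0. Up to rounding, N s r = 1/2; the factor 2 in the denominator of
    \<open>r\<close> absorbs the rounding of \<open>N\<close>.\<close>
  define r where "r t = sqrt t / (2 * ln t ^ 3)" for t :: real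
  define s where "s t = ln t / sqrt t" for t :: real
  define N where "N t = nat \<lceil>(ln t)\<^sup>2\<rceil>" for t :: real
  \<comment> \<open>The choice t ln t for \<open>\<mu>\<close> makes the error (A + B t)/(2 t ln t)
    vanish while ln(t ln t) is still asymptotic to ln t.\<close>
  define lo where "lo t = ln t * ((m - (A + B * t) / (2 * (t * ln t))) / (C + ln (t * ln t) / 2))" for t
  define up where "up t = ln t * ((m + 2 * ln (r t) * (1 / (ln t)\<^sup>2 + exp (- ((ln t)\<^sup>2 / 4 * v))) * K) / (ln (r t) - C))" for t
  show "(lo \<longlongrightarrow> 2 * m) at_top"
    unfolding lo_def by real_asymp
  show "(up \<longlongrightarrow> 2 * m) at_top"
    unfolding up_def r_def using v by real_asymp
  have "eventually (\<lambda>t. 0 < C + ln (t * ln t) / 2) at_top" by real_asymp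
  moreover have ev: "eventually (\<lambda>t::real. 1 < ln t) at_top" by real_asymp
  ultimately show "eventually (\<lambda>t. lo t \<le> ln t * M t) at_top"
    using eventually_gt_at_top[of 0]
  proof eventually_elim
    case (elim t)
    then have "0 < t * ln t" by (intro mult_pos_pos) linarith+
    with elim have "m - (A + B * t) / (2 * (t * ln t)) \<le> M t * (C + ln (t * ln t) / 2)"
      using upper[of t "t * ln t"] by (simp add: mult.commute[of "M t"])
    then have "(m - (A + B * t) / (2 * (t * ln t))) / (C + ln (t * ln t) / 2) \<le> M t"
      using elim by (simp add: pos_divide_le_eq)
    then show ?case unfolding lo_def using elim by (intro mult_left_mono) linarith+
  qed
  have "eventually (\<lambda>t. 0 < ln (r t) - C) at_top" unfolding r_def by real_asymp
  moreover have "eventually (\<lambda>t. 1 \<le> r t) at_top" unfolding r_def by real_asymp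
  moreover have "eventually (\<lambda>t. 2 * (ln t)\<^sup>2 * (ln t / sqrt t) * d \<le> 1) at_top" by real_asymp
  ultimately show "eventually (\<lambda>t. ln t * M t \<le> up t) at_top"
    using eventually_gt_at_top[of 0] ev
  proof eventually_elim
    case (elim t)
    \<comment> \<open>For a number above 1, rounding up at most doubles it.\<close>
    have L: "1 < (ln t)\<^sup>2" using elim by (simp add: one_less_power)
    have N: "(ln t)\<^sup>2 \<le> real (N t)" "real (N t) \<le> 2 * (ln t)\<^sup>2"
      unfolding N_def using L by linarith+
    have "0 < ln t" and ln_nonzero: "ln t \<noteq> 0" using elim by linarith+
    then have s: "0 < s t" unfolding s_def using elim by (intro divide_pos_pos) auto
    have "real (N t) * (s t * d) \<le> 2 * (ln t)\<^sup>2 * (s t * d)"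
      using N(2) s d by (intro mult_right_mono) auto
    also have "\<dots> \<le> 1" using elim by (simp only: s_def mult.assoc)
    finally have Nsd: "real (N t) * s t * d \<le> 1" by (simp only: mult.assoc)
    have "real (N t) * (s t * r t) \<le> 2 * (ln t)\<^sup>2 * (s t * r t)"
      using N(2) s elim by (intro mult_right_mono) auto
    also have "\<dots> = 1" using elim ln_nonzero by (simp add: s_def r_def power2_eq_square power3_eq_cube)
    finally have Nsr: "real (N t) * s t * r t \<le> 1" by (simp add: mult.assoc)
    have ts: "- t * ((s t)\<^sup>2 / 4 * v) = - ((ln t)\<^sup>2 / 4 * v)"
      using elim by (simp add: s_def power_divide)
    have ln_r: "0 \<le> ln (r t)" using elim by simp
    have "1 / real (N t) \<le> 1 / (ln t)\<^sup>2" using N L by (intro divide_left_mono mult_pos_pos) linarith+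
    then have "2 * ln (r t) * (1 / real (N t) + exp (- ((ln t)\<^sup>2 / 4 * v))) * K
        \<le> 2 * ln (r t) * (1 / (ln t)\<^sup>2 + exp (- ((ln t)\<^sup>2 / 4 * v))) * K"
      using ln_r K by (intro mult_right_mono mult_left_mono) auto
    moreover have "0 < N t" using N(1) L by (cases "N t") auto
    then have "(ln (r t) - C) * M t - 2 * ln (r t) * (1 / real (N t) + exp (- ((ln t)\<^sup>2 / 4 * v))) * K \<le> m"
      using lower[of t "r t" "N t" "s t"] Nsd Nsr s elim by (simp only: ts)
    ultimately have "M t * (ln (r t) - C) \<le> m + 2 * ln (r t) * (1 / (ln t)\<^sup>2 + exp (- ((ln t)\<^sup>2 / 4 * v))) * K"
      by (simp only: mult.commute[of "M t"])
    then have "M t \<le> (m + 2 * ln (r t) * (1 / (ln t)\<^sup>2 + exp (- ((ln t)\<^sup>2 / 4 * v))) * K) / (ln (r t) - C)"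
      using elim by (simp add: pos_le_divide_eq)
    then show ?case unfolding up_def using elim by (intro mult_left_mono) linarith+
  qed
qed

lemma C2_compact_imp_continuous:
  assumes "C2_compact f"
  shows "continuous_on UNIV f"
proof -
  obtain f' :: "'a \<Rightarrow> 'a \<Rightarrow>\<^sub>L real" where "\<forall>x. (f has_derivative blinfun_apply (f' x)) (at x)"
    using assms unfolding C2_compact_def by blast
  then show ?thesis
    by (intro continuous_at_imp_continuous_on ballI) (blast intro: has_derivative_continuous)
qed

section \<open>Pairing with the logarithmic stationary solution\<close>

context killed_jump
begin

lemma killed_conv_stationary:
  assumes "log_stationary J H \<phi>"
  shows "killed_conv \<phi> = \<phi>"
proof
  fix x
  show "killed_conv \<phi> x = \<phi> x"
    using assms by (cases "x \<in> H") (auto simp: killed_conv_def log_stationary_def nonlocal_op_def)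
qed

lemma log_stationary_bound:
  assumes "log_stationary J H \<phi>"
  obtains C where "0 \<le> C" "AE x in lebesgue. x \<notin> H \<longrightarrow> \<bar>\<phi> x - ln (norm x)\<bar> \<le> C"
proof -
  obtain C where "AE x in lebesgue_on (- H). \<bar>\<phi> x - ln (norm x)\<bar> \<le> C"
    using assms by (auto simp: log_stationary_def Linfty_on_def)
  then have "AE x in lebesgue. x \<in> - H \<longrightarrow> \<bar>\<phi> x - ln (norm x)\<bar> \<le> C"
    using lebesgue_H by (subst (asm) AE_restrict_space_iff) (auto simp: Compl_in_sets_lebesgue)
  then have "AE x in lebesgue. x \<notin> H \<longrightarrow> \<bar>\<phi> x - ln (norm x)\<bar> \<le> max 0 C"
    by eventually_elim auto
  then show ?thesis by (rule that[rotated]) simp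
qed

text \<open>Off \<open>H\<close> one has |x| >= 1, hence 0 <= ln |x| <= |x|^2, and
  \<open>\<phi>\<close> is dominated by |x|^2 + C almost everywhere.\<close>

lemma integrable_mult_log_stationary:
  assumes \<phi>: "log_stationary J H \<phi>" and H: "ball 0 1 \<subseteq> H"
    and f: "integrable lebesgue f" "integrable lebesgue (\<lambda>x. f x * (norm x)\<^sup>2)"
  shows "integrable lebesgue (\<lambda>x. f x * \<phi> x)"
proof -
  obtain C where C: "0 \<le> C" "AE x in lebesgue. x \<notin> H \<longrightarrow> \<bar>\<phi> x - ln (norm x)\<bar> \<le> C"
    using log_stationary_bound[OF \<phi>] .
  show ?thesis
  proof (rule Bochner_Integration.integrable_bound)
    show "integrable lebesgue (\<lambda>x. \<bar>f x * (norm x)\<^sup>2\<bar> + C * \<bar>f x\<bar>)" using f by simp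
    show "(\<lambda>x. f x * \<phi> x) \<in> borel_measurable lebesgue"
      using f \<phi> by (intro borel_measurable_times) (auto simp: log_stationary_def)
    show "AE x in lebesgue. norm (f x * \<phi> x) \<le> norm (\<bar>f x * (norm x)\<^sup>2\<bar> + C * \<bar>f x\<bar>)"
      using C(2)
    proof eventually_elim
      case (elim x)
      have "\<bar>\<phi> x\<bar> \<le> (norm x)\<^sup>2 + C"
      proof (cases "x \<in> H")
        case True
        then show ?thesis using \<phi> C(1) by (simp add: log_stationary_def)
      next
        case False
        then have x: "1 \<le> norm x" using H by (metis dist_0_norm linorder_not_le mem_ball subsetD)
        then have "norm x * 1 \<le> norm x * norm x" by (intro mult_left_mono) auto
        moreover have "ln (norm x) \<le> norm x - 1" using x by (intro ln_le_minus_one) linarith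
        moreover have "0 \<le> ln (norm x)" using x by simp
        moreover have "\<bar>\<phi> x - ln (norm x)\<bar> \<le> C" using elim False by simp
        ultimately show ?thesis unfolding power2_eq_square by linarith
      qed
      then have "\<bar>f x\<bar> * \<bar>\<phi> x\<bar> \<le> \<bar>f x\<bar> * ((norm x)\<^sup>2 + C)" by (intro mult_left_mono) auto
      then show ?case using C(1) by (simp add: abs_mult algebra_simps)
    qed
  qed
qed

text \<open>The bounds for fixed \<open>k\<close> are linear in the pairings \<open>a k\<close>, so
  averaging them with Poisson weights of mean t replaces \<open>a k\<close> by the mass at time
  t.\<close>

lemma log_times_mass_tendsto:
  assumes sol: "exterior_solution J H u\<^sub>0 u" and \<phi>: "log_stationary J H \<phi>" and H: "ball 0 1 \<subseteq> H"
    and u0: "u\<^sub>0 \<in> borel_measurable lebesgue" "AE x in lebesgue. 0 \<le> u\<^sub>0 x"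
      "integrable lebesgue (\<lambda>x. u\<^sub>0 x * (norm x)\<^sup>2)"
  shows "((\<lambda>t. ln t * (LINT x|lebesgue. u t x)) \<longlongrightarrow> 2 * (LINT x|lebesgue. u\<^sub>0 x * \<phi> x)) at_top"
proof -
  obtain C where C: "0 \<le> C" "AE x in lebesgue. x \<notin> H \<longrightarrow> \<bar>\<phi> x - ln (norm x)\<bar> \<le> C"
    using log_stationary_bound[OF \<phi>] .
  obtain e :: 'a where e: "norm e = 1" using nonempty_Basis norm_Basis by blast
  have C_up: "AE x in lebesgue. x \<notin> H \<longrightarrow> \<phi> x \<le> ln (norm x) + C"
    and C_lo: "AE x in lebesgue. x \<notin> H \<longrightarrow> ln (norm x) - C \<le> \<phi> x"
    using C(2) by (auto elim!: eventually_mono simp: abs_le_iff)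
  have lbm: "locally_bounded_measurable \<phi>"
    using \<phi> by (simp add: log_stationary_def locally_bounded_measurable_def)
  note fixed = killed_conv_stationary[OF \<phi>]
  have H0: "0 \<in> H" using H by auto
  \<comment> \<open>The datum is integrable because it agrees almost everywhere with the value at
    time 0 of a curve in L^1.\<close>
  have "integrable lebesgue (u 0)" and "AE x in lebesgue. u 0 x = u\<^sub>0 x"
    using sol by (auto simp: exterior_solution_def C_L1_def)
  then have u0_int: "integrable lebesgue u\<^sub>0"
    using u0(1) integrable_cong_AE[of "u 0" lebesgue u\<^sub>0] by auto
  note u0_\<phi> = integrable_mult_log_stationary[OF \<phi> H u0_int u0(3)]
  define m where "m = (LINT x|lebesgue. u\<^sub>0 x * \<phi> x)"
  define a where "a k = (LINT x|lebesgue. u\<^sub>0 x * survival k x)" for k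
  define M where "M t = (LINT x|lebesgue. u t x)" for t
  define w where "w t k = exp (- t) * t ^ k / fact k" for t :: real and k
  define A where "A = (LINT x|lebesgue. u\<^sub>0 x * (norm x)\<^sup>2)"
  define V where "V = (LINT y|lborel. J y * (norm y)\<^sup>2)"
  define K where "K = (LINT x|lebesgue. u\<^sub>0 x)"
  define v where "v = (LINT y|lborel. J y * (y \<bullet> e)\<^sup>2)"
  have w_nonneg: "0 \<le> w t k" if "0 < t" for t k using that by (simp add: w_def)
  have w_1: "w t sums 1" for t using poisson_sums(1)[of t 1] by (simp add: w_def[abs_def])
  have w_a: "(\<lambda>k. w t k * a k) sums M t" if "0 < t" for t
    using exterior_solution_mass_sums[OF sol u0(1) that] by (simp add: w_def a_def M_def)
  \<comment> \<open>Averaging turns the factor \<open>real k\<close> into the Poisson mean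
    t.\<close>
  have upper: "m \<le> (C + ln \<mu> / 2) * M t + (A + (V * K) * t) / (2 * \<mu>)" if t: "0 < t" and \<mu>: "0 < \<mu>" for t \<mu>
  proof -
    have "m \<le> (C + ln \<mu> / 2) * a k + (A + V * real k * K) / (2 * \<mu>)" for k
      unfolding m_def a_def A_def V_def K_def
      by (rule stationary_pairing_le[OF lbm fixed C_up H0 \<mu> u0(2) u0_int u0(3) u0_\<phi> integrable_mult_survival[OF u0_int]])
    then have "w t k * m \<le> w t k * ((C + ln \<mu> / 2) * a k + (A + V * real k * K) / (2 * \<mu>))" for k
      using w_nonneg[OF t] by (rule mult_left_mono)
    moreover have "w t k * ((C + ln \<mu> / 2) * a k + (A + V * real k * K) / (2 * \<mu>)) =
        (C + ln \<mu> / 2) * (w t k * a k) + (A / (2 * \<mu>) * w t k + V * K / (2 * \<mu>) * (w t k * real k))" for k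
      by (simp add: algebra_simps add_divide_distrib)
    ultimately have "w t k * m \<le> (C + ln \<mu> / 2) * (w t k * a k) + (A / (2 * \<mu>) * w t k + V * K / (2 * \<mu>) * (w t k * real k))" for k
      by simp
    moreover have "(\<lambda>k. w t k * m) sums (1 * m)" by (intro sums_mult2 w_1)
    moreover have "(\<lambda>k. (C + ln \<mu> / 2) * (w t k * a k) + (A / (2 * \<mu>) * w t k + V * K / (2 * \<mu>) * (w t k * real k)))
        sums ((C + ln \<mu> / 2) * M t + (A / (2 * \<mu>) * 1 + V * K / (2 * \<mu>) * t))"
      using poisson_sums(2)[of t] by (intro sums_add sums_mult w_a w_1 t) (simp add: w_def)
    ultimately have "1 * m \<le> (C + ln \<mu> / 2) * M t + (A / (2 * \<mu>) * 1 + V * K / (2 * \<mu>) * t)"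
      by (rule sums_le)
    then show ?thesis by (simp add: add_divide_distrib)
  qed
  \<comment> \<open>Averaging turns the k-th power of 1 - s^2 v / 4 into exp(- t s^2 v / 4) by the
    generating function.\<close>
  have lower: "(ln r - C) * M t - 2 * ln r * (1 / real N + exp (- t * (s\<^sup>2 / 4 * v))) * K \<le> m"
    if t: "0 < t" and par: "1 \<le> r" "0 < N" "0 < s" "real N * s * d \<le> 1" "real N * s * r \<le> 1" for t r N s
  proof -
    have "(ln r - C) * a k - 2 * ln r * (1 / real N + (1 - s\<^sup>2 / 4 * v) ^ k) * K \<le> m" for k
      unfolding m_def a_def K_def v_def
      by (rule stationary_pairing_ge[OF lbm fixed C_lo H par(1) e par(2-5) u0(2) u0_int u0_\<phi> integrable_mult_survival[OF u0_int]])
    then have "w t k * ((ln r - C) * a k - 2 * ln r * (1 / real N + (1 - s\<^sup>2 / 4 * v) ^ k) * K) \<le> w t k * m" for k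
      using w_nonneg[OF t] by (rule mult_left_mono)
    moreover have "w t k * ((ln r - C) * a k - 2 * ln r * (1 / real N + (1 - s\<^sup>2 / 4 * v) ^ k) * K) =
        (ln r - C) * (w t k * a k) - 2 * ln r * K * (1 / real N * w t k + w t k * (1 - s\<^sup>2 / 4 * v) ^ k)" for k
      by (simp add: algebra_simps)
    ultimately have "(ln r - C) * (w t k * a k) - 2 * ln r * K * (1 / real N * w t k + w t k * (1 - s\<^sup>2 / 4 * v) ^ k) \<le> w t k * m" for k
      by simp
    moreover have "(\<lambda>k. (ln r - C) * (w t k * a k) - 2 * ln r * K * (1 / real N * w t k + w t k * (1 - s\<^sup>2 / 4 * v) ^ k))
        sums ((ln r - C) * M t - 2 * ln r * K * (1 / real N * 1 + exp (- t * (1 - (1 - s\<^sup>2 / 4 * v)))))"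
      unfolding w_def
      by (intro sums_diff sums_add sums_mult w_a[unfolded w_def] w_1[unfolded w_def[abs_def]] t poisson_sums)
    moreover have "(\<lambda>k. w t k * m) sums (1 * m)" by (intro sums_mult2 w_1)
    ultimately have "(ln r - C) * M t - 2 * ln r * K * (1 / real N * 1 + exp (- t * (1 - (1 - s\<^sup>2 / 4 * v)))) \<le> 1 * m"
      by (rule sums_le)
    then show ?thesis by (simp add: mult.commute mult.left_commute)
  qed
  have "0 \<le> K" unfolding K_def using u0(2) by (rule integral_nonneg_AE)
  moreover have "0 < v" unfolding v_def by (rule directional_variance_pos[OF e])
  ultimately have "((\<lambda>t. ln t * M t) \<longlongrightarrow> 2 * m) at_top"
    using logarithmic_decay_limit[OF upper lower _ _ d_pos] by blast
  then show ?thesis by (simp add: M_def m_def)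
qed

end

theorem proposition4p1:
  fixes H :: "(real^2) set" and J u\<^sub>0 \<phi> :: "real^2 \<Rightarrow> real"
    and u :: "real \<Rightarrow> real^2 \<Rightarrow> real" and R d :: real
  assumes "H \<noteq> {}" and "bounded H" and "open H"
    and "2 < R" and "ball 0 2 \<subseteq> H" and "H \<subseteq> ball 0 R"
    and "C2_compact J"
    and "\<And>x y. norm x = norm y \<Longrightarrow> J x = J y"
    and "0 < d"
    and "\<And>x. norm x < d \<Longrightarrow> J x > 0"
    and "\<And>x. norm x \<ge> d \<Longrightarrow> J x = 0"
    and "(LINT x|lebesgue. J x) = 1"
    and "AE x in lebesgue. u\<^sub>0 x \<ge> 0"
    and "AE x in lebesgue. x \<in> H \<longrightarrow> u\<^sub>0 x = 0"
    and "Linfty_on UNIV u\<^sub>0"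
    and "integrable lebesgue (\<lambda>x. u\<^sub>0 x * ln (norm x))"
    and "integrable lebesgue (\<lambda>x. u\<^sub>0 x * (norm x)\<^sup>2)"
    and "exterior_solution J H u\<^sub>0 u"
    and "log_stationary J H \<phi>"
  shows "((\<lambda>t. ln t * (LINT x|lebesgue. u t x)) \<longlongrightarrow> 2 * (LINT x|lebesgue. u\<^sub>0 x * \<phi> x)) at_top"
proof -
  have cont: "continuous_on UNIV J" by (rule C2_compact_imp_continuous[OF assms(7)])
  have "(LINT x|lborel. J x) = 1"
    using assms(12) borel_measurable_continuous_onI[OF cont] integral_completion[of J lborel] by simp
  moreover have "0 \<le> J x" for x
    using assms(10,11)[of x] by (cases "norm x < d") auto
  moreover have "J (- x) = J x" for x by (rule assms(8)) simp
  ultimately interpret killed_jump J d H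
    using cont assms(3,9,11) by unfold_locales auto
  have "ball 0 1 \<subseteq> H" using assms(5) by (auto simp: subset_iff)
  moreover have "u\<^sub>0 \<in> borel_measurable lebesgue"
    using assms(15) by (simp add: Linfty_on_def lebesgue_on_UNIV_eq)
  ultimately show ?thesis
    using assms(13,17,18,19) by (intro log_times_mass_tendsto)
qed

end
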